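(* Assume $RP([\omega_2]^\omega)$. Then there is no ideal $I$ which bounds its completeness and concentrates on $GIC_{\omega_1}$.
   Context: The base theory is ZFC. $[X]^\omega$ is the set of countable subsets of $X$; a club in $[X]^\omega$ is a $\subseteq$-cofinal subset closed under unions of countable increasing chains, and stationary means meeting every club. $RP([\omega_2]^\omega)$: for every stationary $S\subseteq[\omega_2]^\omega$ there is $X\subseteq\omega_2$ with $\omega_1\subseteq X$, $|X|=\omega_1$ and $S\cap[X]^\omega$ stationary in $[X]^\omega$. $GIC_{\omega_1}$. $ZF^-$ is ZF without Power Set. A transitive $ZF^-$ model $H$ with $\omega_1\in H$ has the $\omega_1$-approximation property iff for every $\eta\in H$ and $A\subseteq\eta$: if $z\cap A\in H$ for every $z\in H$ which is countable in $H$, then $A\in H$. A set $M$ with $\omega_1\subset M\prec H_\theta$ for some regular uncountable $\theta$ is $\omega_1$-guessing iff its transitive collapse has the $\omega_1$-approximation property. $G_{\omega_1}$ is the class of $\omega_1$-guessing $M$ with $|M|=\omega_1\subset M$. $IC_{\omega_1}$ (internally club sets) is the class of $M$ with $(M,\in)\models ZF^-$, $\omega_1\subseteq M$, $|M|=\omega_1$, such that $M\cap[M]^\omega$ contains a club in $[M]^\omega$. $GIC_{\omega_1}=G_{\omega_1}\cap IC_{\omega_1}$. Ideals. Here an ideal is an ideal $I\subset\wp(Z)$ with $Z=\wp_{\omega_2}(H_\theta)$ for some regular $\theta\ge\omega_2$, which is proper, countably complete, fine (for every $b\in H_\theta$, $\{M\in Z: b\notin M\}\in I$) and normal (if $S\notin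 I$ and $g$ is a function on $S$ with $g(M)\in M$ for all $M\in S$, then $g$ is constant on some $S'\subseteq S$ with $S'\notin I$). $\breve I$ is the dual filter. $I$ concentrates on a class $\Gamma$ iff some $A\subseteq\Gamma$ belongs to $\breve I$. The completeness of $I$ is the cardinal $\mu$ such that $I$ is closed under unions of fewer than $\mu$ of its members but not under unions of $\mu$ of its members. $I$, with completeness $\mu\subseteq H_\theta$, bounds its completeness iff for every $f:\mu\to\mu$ the set of $M\in Z$ with $otp(M\cap ORD)>f(M\cap\mu)$ belongs to $\breve I$ (note $M\cap\mu\in\mu$ for $\breve I$-almost all $M$). *)

theory Defs
  imports Main "HOL-Library.Equipollence" "HOL-Library.Countable_Set" "HOL-Library.FuncSet"
begin

section \<open>The universe of sets\<close>

text \<open>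
  A type in this class is a universe of sets, the map \<open>elts\<close> sending a set to the collection of its
  members.  Separation and Replacement range over arbitrary collections and functions of the logic,
  and the axiom of choice is inherited from the logic.  Of Power Set only the existence of two
  uncountable cardinalities (hence of \<open>\<omega>\<^sub>2\<close>) is required.  Up to isomorphism these universes are
  exactly the structures \<open>H\<^sub>\<kappa>\<close> for regular \<open>\<kappa> > \<omega>\<^sub>2\<close>, and the universes that satisfy full ZFC are
  those with \<open>\<kappa>\<close> inaccessible.  Asking for Power Set would therefore restrict the cardinals \<open>\<theta>\<close>
  considered below to those lying under an inaccessible.  Power sets of the sets in the
  universe, and of \<open>H\<^sub>\<theta>\<close>, are always available as sets of the logic.
\<close>

class set_universe =
  fixes elts :: "'a \<Rightarrow> 'a set"
  assumes extensionality: "elts x = elts y \<Longrightarrow> x = y"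
    and foundation: "wf {(x, y). x \<in> elts y}"
    and pairing: "\<exists>z. elts z = {x, y}"
    and union: "\<exists>y. elts y = (\<Union>z\<in>elts x. elts z)"
    and infinity: "\<exists>x. (\<exists>e\<in>elts x. elts e = {}) \<and>
                       (\<forall>y\<in>elts x. \<exists>s\<in>elts x. elts s = insert y (elts y))"
    and replacement: "A \<subseteq> elts x \<Longrightarrow> \<exists>y. elts y = f ` A"
    and two_uncountable: "\<exists>x y. uncountable (elts x) \<and> elts x \<prec> elts y"

text \<open>\<open>the_set A\<close> is only meaningful if \<open>A\<close> is the collection of members of some set.\<close>

definition the_set :: "'v::set_universe set \<Rightarrow> 'v" where
  "the_set A = (THE x. elts x = A)"

lemma the_set_elts [simp]: "the_set (elts x) = x"
  unfolding the_set_def by (rule the_equality) (rule refl, rule extensionality)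

lemma elts_the_set:
  fixes f :: "'v::set_universe \<Rightarrow> 'v"
  assumes "A \<subseteq> elts x"
  shows "elts (the_set (f ` A)) = f ` A"
proof -
  obtain y where y: "elts y = f ` A" using replacement[OF assms, of f] ..
  show ?thesis unfolding y[symmetric] the_set_elts ..
qed

definition pair :: "'v::set_universe \<Rightarrow> 'v \<Rightarrow> 'v" where
  "pair x y = the_set {the_set {x, x}, the_set {x, y}}"

definition transitive :: "'v::set_universe set \<Rightarrow> bool" where
  "transitive H \<longleftrightarrow> (\<forall>x\<in>H. elts x \<subseteq> H)"

section \<open>Ordinals and cardinals\<close>

definition Ord :: "'v::set_universe \<Rightarrow> bool" where
  "Ord \<alpha> \<longleftrightarrow> transitive (elts \<alpha>) \<and> (\<forall>\<beta>\<in>elts \<alpha>. transitive (elts \<beta>))"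

definition Card :: "'v::set_universe \<Rightarrow> bool" where
  "Card \<kappa> \<longleftrightarrow> Ord \<kappa> \<and> (\<forall>\<alpha>\<in>elts \<kappa>. elts \<alpha> \<prec> elts \<kappa>)"

definition regular :: "'v::set_universe \<Rightarrow> bool" where
  "regular \<kappa> \<longleftrightarrow> Card \<kappa> \<and> infinite (elts \<kappa>) \<and>
     (\<forall>A. A \<subseteq> elts \<kappa> \<and> A \<prec> elts \<kappa> \<longrightarrow> (\<exists>\<beta>\<in>elts \<kappa>. A \<subseteq> elts \<beta>))"

definition omega :: "'v::set_universe" where
  "omega = (THE \<alpha>. Ord \<alpha> \<and> infinite (elts \<alpha>) \<and> (\<forall>\<beta>\<in>elts \<alpha>. finite (elts \<beta>)))"

definition omega1 :: "'v::set_universe" where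
  "omega1 = (THE \<alpha>. Ord \<alpha> \<and> uncountable (elts \<alpha>) \<and> (\<forall>\<beta>\<in>elts \<alpha>. countable (elts \<beta>)))"

definition omega2 :: "'v::set_universe" where
  "omega2 = (THE \<alpha>. Ord \<alpha> \<and> elts (omega1 :: 'v) \<prec> elts \<alpha> \<and> (\<forall>\<beta>\<in>elts \<alpha>. elts \<beta> \<lesssim> elts (omega1 :: 'v)))"

text \<open>The axioms ensure that \<open>\<omega>\<^sub>1\<close> and \<open>\<omega>\<^sub>2\<close> exist, so the descriptions above are proper.\<close>

lemma mem_induct: "(\<And>x. (\<And>y. y \<in> elts x \<Longrightarrow> P y) \<Longrightarrow> P x) \<Longrightarrow> P (x :: 'v::set_universe)"
  by (rule wf_induct_rule[OF foundation]) auto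

lemma mem_minimal:
  fixes x :: "'v::set_universe"
  assumes "P x"
  obtains m where "P m" "\<And>y. y \<in> elts m \<Longrightarrow> \<not> P y"
  using wfE_min[OF foundation, of x "Collect P"] assms by auto

lemma mem_irrefl: "x \<notin> elts (x :: 'v::set_universe)"
  using wf_not_refl[OF foundation, of x] by simp

lemma Ord_member: "Ord \<alpha> \<Longrightarrow> \<beta> \<in> elts \<alpha> \<Longrightarrow> Ord \<beta>"
  unfolding Ord_def transitive_def by blast

lemma Ord_linear:
  fixes \<alpha> \<beta> :: "'v::set_universe"
  shows "Ord \<alpha> \<Longrightarrow> Ord \<beta> \<Longrightarrow> \<alpha> \<in> elts \<beta> \<or> \<alpha> = \<beta> \<or> \<beta> \<in> elts \<alpha>"
proof (induction \<alpha> arbitrary: \<beta> rule: mem_induct)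
  case (1 \<alpha>)
  note IH1 = 1
  from IH1(3) show ?case
  proof (induction \<beta> rule: mem_induct)
    case (1 \<beta>)
    show ?case
    proof (rule ccontr)
      assume n: "\<not> ?thesis"
      have "elts \<alpha> \<subseteq> elts \<beta>"
      proof
        fix x assume x: "x \<in> elts \<alpha>"
        then have "x \<in> elts \<beta> \<or> x = \<beta> \<or> \<beta> \<in> elts x"
          using IH1(1)[OF x Ord_member[OF IH1(2) x] 1(2)] by blast
        then show "x \<in> elts \<beta>"
          using n x IH1(2) unfolding Ord_def transitive_def by blast
      qed
      moreover have "elts \<beta> \<subseteq> elts \<alpha>"
      proof
        fix x assume x: "x \<in> elts \<beta>"
        then have "\<alpha> \<in> elts x \<or> \<alpha> = x \<or> x \<in> elts \<alpha>"
          using 1(1)[OF x Ord_member[OF 1(2) x]] by blast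
        then show "x \<in> elts \<alpha>"
          using n x 1(2) unfolding Ord_def transitive_def by blast
      qed
      ultimately show False using n extensionality[of \<alpha> \<beta>] by blast
    qed
  qed
qed

lemma Ord_eqpoll:
  fixes y :: "'v::set_universe"
  obtains \<alpha> :: 'v where "Ord \<alpha>" "elts \<alpha> \<approx> elts y"
proof -
  obtain r where r: "well_order_on (elts y) r" using well_order_on by blast
  have wf: "wf (r - Id)" using r unfolding well_order_on_def by blast
  have fld: "a \<in> elts y \<and> b \<in> elts y" if "(a, b) \<in> r" for a b
    using well_order_on_domain[OF r that] .
  have tr: "trans (r - Id)"
    using r unfolding well_order_on_def linear_order_on_def partial_order_on_def preorder_on_def
    by (blast intro: trans_diff_Id)
  have tot: "a = b \<or> (a, b) \<in> r - Id \<or> (b, a) \<in> r - Id" if "a \<in> elts y" "b \<in> elts y" for a b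
    using that r unfolding well_order_on_def linear_order_on_def total_on_def by blast
  define h :: "'v \<Rightarrow> 'v" where "h = wfrec (r - Id) (\<lambda>c a. the_set (c ` {b. (b, a) \<in> r - Id}))"
  have h0: "h a = the_set (h ` {b. (b, a) \<in> r - Id})" for a
  proof -
    have "h a = the_set (cut h (r - Id) a ` {b. (b, a) \<in> r - Id})"
      unfolding h_def by (subst wfrec[OF wf]) (rule refl)
    also have "cut h (r - Id) a ` {b. (b, a) \<in> r - Id} = h ` {b. (b, a) \<in> r - Id}"
      by (rule image_cong) (simp_all add: cut_apply)
    finally show ?thesis .
  qed
  have h: "elts (h a) = h ` {b. (b, a) \<in> r - Id}" for a
    unfolding h0[of a] proof (rule elts_the_set)
    show "{b. (b, a) \<in> r - Id} \<subseteq> elts y" using fld by blast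
  qed
  define \<alpha> where "\<alpha> = the_set (h ` elts y)"
  have e: "elts \<alpha> = h ` elts y" unfolding \<alpha>_def by (rule elts_the_set) (rule subset_refl)
  have sub: "elts (h b) \<subseteq> elts (h a)" if "(b, a) \<in> r - Id" for a b
    unfolding h using that transD[OF tr] by blast
  have th: "transitive (elts (h a))" for a
    unfolding transitive_def using sub[of _ a] h[of a] by auto
  have "transitive (elts \<alpha>)"
    unfolding transitive_def e h using fld h by auto
  then have Ord: "Ord \<alpha>" unfolding Ord_def e using th by auto
  have "inj_on h (elts y)"
  proof (rule inj_onI)
    fix a b assume ab: "a \<in> elts y" "b \<in> elts y" "h a = h b"
    have "h a \<in> elts (h b)" if "(a, b) \<in> r - Id" for a b using h that by blast
    then show "a = b" using tot[OF ab(1,2)] ab(3) mem_irrefl by force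
  qed
  then have "elts \<alpha> \<approx> elts y" unfolding e by (rule inj_on_image_eqpoll_self)
  with Ord show thesis by (rule that)
qed

lemma omega1:
  "Ord (omega1 :: 'v::set_universe)" "uncountable (elts (omega1 :: 'v))"
  "\<beta> \<in> elts omega1 \<Longrightarrow> countable (elts (\<beta> :: 'v))"
proof -
  let ?Q = "\<lambda>\<alpha>::'v. Ord \<alpha> \<and> uncountable (elts \<alpha>) \<and> (\<forall>\<beta>\<in>elts \<alpha>. countable (elts \<beta>))"
  obtain x :: 'v where x: "uncountable (elts x)" using two_uncountable by blast
  obtain a :: 'v where a: "Ord a" "elts a \<approx> elts x" by (rule Ord_eqpoll[of x])
  have "Ord a \<and> uncountable (elts a)"
    using a(1) x countable_eqpoll[OF _ eqpoll_sym[OF a(2)]] by blast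
  then obtain m :: 'v where m: "Ord m \<and> uncountable (elts m)"
    "\<And>y. y \<in> elts m \<Longrightarrow> \<not> (Ord y \<and> uncountable (elts y))"
    by (rule mem_minimal[where P = "\<lambda>a. Ord a \<and> uncountable (elts a)"]) (rule that)
  have Q: "?Q m" using m(1) m(2) Ord_member[of m] by auto
  moreover have "\<alpha> = m" if "?Q \<alpha>" for \<alpha>
    using that Q Ord_linear[of \<alpha> m] by auto
  ultimately have "?Q omega1" unfolding omega1_def by (rule theI)
  then show "Ord (omega1 :: 'v)" "uncountable (elts (omega1 :: 'v))"
    "\<beta> \<in> elts omega1 \<Longrightarrow> countable (elts \<beta>)" by blast+
qed

lemma omega2:
  "Ord (omega2 :: 'v::set_universe)" "elts (omega1 :: 'v) \<prec> elts (omega2 :: 'v)"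
  "\<beta> \<in> elts omega2 \<Longrightarrow> elts (\<beta> :: 'v) \<lesssim> elts (omega1 :: 'v)"
proof -
  let ?w = "elts (omega1 :: 'v)"
  let ?Q = "\<lambda>\<alpha>::'v. Ord \<alpha> \<and> ?w \<prec> elts \<alpha> \<and> (\<forall>\<beta>\<in>elts \<alpha>. elts \<beta> \<lesssim> ?w)"
  have tot: "A \<lesssim> B \<or> B \<prec> A" for A B :: "'v set"
  proof -
    have "A \<lesssim> B \<or> B \<lesssim> A"
      using ordLeq_total[OF card_of_Well_order card_of_Well_order, of A B]
      unfolding lepoll_def card_of_ordLeq .
    then show ?thesis
      using eqpoll_imp_lepoll[OF eqpoll_sym, of B A] unfolding lesspoll_def by auto
  qed
  have ge: "?w \<lesssim> elts z" if "uncountable (elts z)" for z :: 'v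
  proof -
    obtain c :: 'v where c: "Ord c" "elts c \<approx> elts z" by (rule Ord_eqpoll[of z])
    have "uncountable (elts c)"
      using that countable_eqpoll[OF _ eqpoll_sym[OF c(2)]] by blast
    then have "c \<notin> elts omega1" using omega1(3) by blast
    then have "?w \<subseteq> elts c"
      using Ord_linear[OF c(1) omega1(1)] c(1) unfolding Ord_def transitive_def by auto
    then show ?thesis using c(2) by (rule lepoll_trans2[OF subset_imp_lepoll])
  qed
  obtain x y :: 'v where x: "uncountable (elts x)" "elts x \<prec> elts y"
    using two_uncountable by blast
  obtain a :: 'v where a: "Ord a" "elts a \<approx> elts y" by (rule Ord_eqpoll[of y])
  have "?w \<prec> elts y" using ge[OF x(1)] x(2) by (rule lesspoll_trans1)
  then have "?w \<prec> elts a" using eqpoll_sym[OF a(2)] by (rule lesspoll_eq_trans)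
  then have "Ord a \<and> ?w \<prec> elts a" using a by blast
  then obtain m :: 'v where m: "Ord m \<and> ?w \<prec> elts m"
    "\<And>y. y \<in> elts m \<Longrightarrow> \<not> (Ord y \<and> ?w \<prec> elts y)"
    by (rule mem_minimal[where P = "\<lambda>a. Ord a \<and> ?w \<prec> elts a"]) (rule that)
  have le: "elts y \<lesssim> ?w" if "y \<in> elts m" for y
    using m(2)[OF that] Ord_member[OF conjunct1[OF m(1)] that] tot[of "elts y" ?w] by auto
  then have Q: "?Q m" using m(1) by auto
  have "\<alpha> = m" if "?Q \<alpha>" for \<alpha>
  proof -
    have "\<alpha> \<notin> elts m" "m \<notin> elts \<alpha>"
      using that Q lesspoll_trans1[of "elts \<alpha>" ?w "elts \<alpha>"] lesspoll_trans1[of "elts m" ?w "elts m"]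
      by auto
    then show ?thesis using that Q Ord_linear[of \<alpha> m] by auto
  qed
  with Q have "?Q omega2" unfolding omega2_def by (rule theI)
  then show "Ord (omega2 :: 'v)" "?w \<prec> elts (omega2 :: 'v)"
    "\<beta> \<in> elts omega2 \<Longrightarrow> elts \<beta> \<lesssim> ?w" by blast+
qed

definition otp :: "'v::set_universe set \<Rightarrow> 'v" where
  "otp A = (THE \<alpha>. Ord \<alpha> \<and>
     (\<exists>h. bij_betw h A (elts \<alpha>) \<and> (\<forall>x\<in>A. \<forall>y\<in>A. x \<in> elts y \<longleftrightarrow> h x \<in> elts (h y))))"

definition trcl :: "'v::set_universe \<Rightarrow> 'v set" where
  "trcl x = {y. (\<lambda>u v. u \<in> elts v)\<^sup>+\<^sup>+ y x}"

definition Hset :: "'v::set_universe \<Rightarrow> 'v set" where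
  "Hset \<theta> = {x. trcl x \<prec> elts \<theta>}"

section \<open>Stationary sets of countable sets\<close>

definition ctbl_subsets :: "'a set \<Rightarrow> 'a set set" where
  "ctbl_subsets X = {a. a \<subseteq> X \<and> countable a}"

definition club :: "'a set \<Rightarrow> 'a set set \<Rightarrow> bool" where
  "club X C \<longleftrightarrow> C \<subseteq> ctbl_subsets X \<and> (\<forall>a\<in>ctbl_subsets X. \<exists>c\<in>C. a \<subseteq> c) \<and>
     (\<forall>c::nat \<Rightarrow> 'a set. range c \<subseteq> C \<and> mono c \<longrightarrow> (\<Union>n. c n) \<in> C)"

definition stationary :: "'a set \<Rightarrow> 'a set set \<Rightarrow> bool" where
  "stationary X S \<longleftrightarrow> S \<subseteq> ctbl_subsets X \<and> (\<forall>C. club X C \<longrightarrow> S \<inter> C \<noteq> {})"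

text \<open>\<open>RP \<kappa>\<close> is the reflection principle for stationary subsets of \<open>[\<kappa>]\<^sup>\<omega>\<close>.\<close>

definition RP :: "'v::set_universe \<Rightarrow> bool" where
  "RP \<kappa> \<longleftrightarrow> (\<forall>S. stationary (elts \<kappa>) S \<longrightarrow>
     (\<exists>X. X \<subseteq> elts \<kappa> \<and> elts (omega1 :: 'v) \<subseteq> X \<and> X \<approx> elts (omega1 :: 'v) \<and>
          stationary X (S \<inter> ctbl_subsets X)))"

section \<open>First-order logic of the membership relation\<close>

datatype fm = Member nat nat | Equal nat nat | Neg fm | And fm fm | Forall nat fm

primrec sat :: "'v::set_universe set \<Rightarrow> fm \<Rightarrow> (nat \<Rightarrow> 'v) \<Rightarrow> bool" where
  "sat D (Member i j) s \<longleftrightarrow> s i \<in> elts (s j)"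
| "sat D (Equal i j) s \<longleftrightarrow> s i = s j"
| "sat D (Neg \<phi>) s \<longleftrightarrow> \<not> sat D \<phi> s"
| "sat D (And \<phi> \<psi>) s \<longleftrightarrow> sat D \<phi> s \<and> sat D \<psi> s"
| "sat D (Forall i \<phi>) s \<longleftrightarrow> (\<forall>x\<in>D. sat D \<phi> (s(i := x)))"

definition elementary :: "'v::set_universe set \<Rightarrow> 'v set \<Rightarrow> bool" where
  "elementary M N \<longleftrightarrow> M \<subseteq> N \<and> (\<forall>\<phi> s. range s \<subseteq> M \<longrightarrow> sat M \<phi> s = sat N \<phi> s)"

text \<open>
  The axioms, in this order: Extensionality, Foundation, Pairing, Union, Infinity, and the schemes
  of Separation and Replacement.  In the schemes the parameters of \<open>\<phi>\<close> are given by \<open>s\<close>; variable 0,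
  and in Replacement also variable 1, serve as the argument places.
\<close>

definition ZF_minus :: "'v::set_universe set \<Rightarrow> bool" where
  "ZF_minus D \<longleftrightarrow>
     (\<forall>x\<in>D. \<forall>y\<in>D. (\<forall>z\<in>D. z \<in> elts x \<longleftrightarrow> z \<in> elts y) \<longrightarrow> x = y) \<and>
     (\<forall>x\<in>D. (\<exists>y\<in>D. y \<in> elts x) \<longrightarrow>
        (\<exists>y\<in>D. y \<in> elts x \<and> \<not> (\<exists>z\<in>D. z \<in> elts x \<and> z \<in> elts y))) \<and>
     (\<forall>x\<in>D. \<forall>y\<in>D. \<exists>z\<in>D. \<forall>w\<in>D. w \<in> elts z \<longleftrightarrow> w = x \<or> w = y) \<and>
     (\<forall>x\<in>D. \<exists>u\<in>D. \<forall>w\<in>D. w \<in> elts u \<longleftrightarrow> (\<exists>y\<in>D. y \<in> elts x \<and> w \<in> elts y)) \<and>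
     (\<exists>x\<in>D. (\<exists>e\<in>D. e \<in> elts x \<and> (\<forall>w\<in>D. w \<notin> elts e)) \<and>
        (\<forall>y\<in>D. y \<in> elts x \<longrightarrow>
           (\<exists>s\<in>D. s \<in> elts x \<and> (\<forall>w\<in>D. w \<in> elts s \<longleftrightarrow> w \<in> elts y \<or> w = y)))) \<and>
     (\<forall>\<phi> s. range s \<subseteq> D \<longrightarrow>
        (\<forall>a\<in>D. \<exists>b\<in>D. \<forall>x\<in>D. x \<in> elts b \<longleftrightarrow> x \<in> elts a \<and> sat D \<phi> (s(0 := x)))) \<and>
     (\<forall>\<phi> s. range s \<subseteq> D \<longrightarrow>
        (\<forall>a\<in>D. (\<forall>x\<in>D. x \<in> elts a \<longrightarrow> (\<exists>!y. y \<in> D \<and> sat D \<phi> (s(0 := x, 1 := y)))) \<longrightarrow>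
           (\<exists>b\<in>D. \<forall>y\<in>D. y \<in> elts b \<longleftrightarrow>
              (\<exists>x\<in>D. x \<in> elts a \<and> sat D \<phi> (s(0 := x, 1 := y))))))"

section \<open>Guessing and internally club sets\<close>

function collapse :: "'v::set_universe set \<Rightarrow> 'v \<Rightarrow> 'v" where
  "collapse M x = the_set (collapse M ` (elts x \<inter> M))"
  by auto
termination
  by (relation "inv_image {(x, y). x \<in> elts y} snd") (auto intro: foundation)

declare collapse.simps [simp del]

definition transitive_collapse :: "'v::set_universe set \<Rightarrow> 'v set" where
  "transitive_collapse M = collapse M ` M"

definition injection :: "'v::set_universe \<Rightarrow> 'v \<Rightarrow> 'v \<Rightarrow> bool" where
  "injection f a b \<longleftrightarrow>
     (\<exists>g. inj_on g (elts a) \<and> g ` elts a \<subseteq> elts b \<and> elts f = (\<lambda>x. pair x (g x)) ` elts a)"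

text \<open>
  For transitive models \<open>N\<close> of \<open>ZF\<^sup>-\<close>, to which this is applied, being an injection of \<open>z\<close> into
  \<open>\<omega>\<close> is absolute.
\<close>

definition countable_in :: "'v::set_universe set \<Rightarrow> 'v \<Rightarrow> bool" where
  "countable_in N z \<longleftrightarrow> (\<exists>f\<in>N. injection f z omega)"

definition omega1_approximation :: "'v::set_universe set \<Rightarrow> bool" where
  "omega1_approximation N \<longleftrightarrow> transitive N \<and> ZF_minus N \<and> omega1 \<in> N \<and>
     (\<forall>\<eta>\<in>N. \<forall>A. elts A \<subseteq> elts \<eta> \<and>
        (\<forall>z\<in>N. countable_in N z \<longrightarrow> the_set (elts z \<inter> elts A) \<in> N) \<longrightarrow> A \<in> N)"

definition omega1_guessing :: "'v::set_universe set \<Rightarrow> bool" where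
  "omega1_guessing M \<longleftrightarrow>
     elts (omega1 :: 'v) \<subseteq> M \<and>
     (\<exists>\<theta>. regular \<theta> \<and> uncountable (elts \<theta>) \<and> elementary M (Hset \<theta>)) \<and>
     omega1_approximation (transitive_collapse M)"

definition G_omega1 :: "'v::set_universe set set" where
  "G_omega1 = {M. omega1_guessing M \<and> M \<approx> elts (omega1 :: 'v) \<and> elts (omega1 :: 'v) \<subseteq> M}"

text \<open>The countable subsets of \<open>M\<close> that are members of \<open>M\<close> form \<open>elts ` M \<inter> ctbl_subsets M\<close>.\<close>

definition IC_omega1 :: "'v::set_universe set set" where
  "IC_omega1 = {M. ZF_minus M \<and> elts (omega1 :: 'v) \<subseteq> M \<and> M \<approx> elts (omega1 :: 'v) \<and>
     (\<exists>C. club M C \<and> C \<subseteq> elts ` M \<inter> ctbl_subsets M)}"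

definition GIC_omega1 :: "'v::set_universe set set" where
  "GIC_omega1 = G_omega1 \<inter> IC_omega1"

section \<open>Ideals\<close>

definition Zset :: "'v::set_universe \<Rightarrow> 'v set set" where
  "Zset \<theta> = {M. M \<subseteq> Hset \<theta> \<and> M \<prec> elts (omega2 :: 'v)}"

definition fine :: "'v::set_universe \<Rightarrow> 'v set set set \<Rightarrow> bool" where
  "fine \<theta> I \<longleftrightarrow> (\<forall>b\<in>Hset \<theta>. {M \<in> Zset \<theta>. b \<notin> M} \<in> I)"

definition normal :: "'v::set_universe \<Rightarrow> 'v set set set \<Rightarrow> bool" where
  "normal \<theta> I \<longleftrightarrow> (\<forall>S g. S \<subseteq> Zset \<theta> \<and> S \<notin> I \<and> (\<forall>M\<in>S. g M \<in> M) \<longrightarrow>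
     (\<exists>S' b. S' \<subseteq> S \<and> S' \<notin> I \<and> (\<forall>M\<in>S'. g M = b)))"

definition ideal :: "'v::set_universe \<Rightarrow> 'v set set set \<Rightarrow> bool" where
  "ideal \<theta> I \<longleftrightarrow>
     regular \<theta> \<and> elts (omega2 :: 'v) \<subseteq> elts \<theta> \<and>
     I \<subseteq> Pow (Zset \<theta>) \<and> {} \<in> I \<and>
     (\<forall>A B. A \<in> I \<and> B \<subseteq> A \<longrightarrow> B \<in> I) \<and>
     (\<forall>\<A>. \<A> \<subseteq> I \<and> countable \<A> \<longrightarrow> \<Union>\<A> \<in> I) \<and>
     Zset \<theta> \<notin> I \<and> fine \<theta> I \<and> normal \<theta> I"

definition dual_filter :: "'v::set_universe \<Rightarrow> 'v set set set \<Rightarrow> 'v set set set" where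
  "dual_filter \<theta> I = {Zset \<theta> - A |A. A \<in> I}"

definition concentrates_on :: "'v::set_universe \<Rightarrow> 'v set set set \<Rightarrow> 'v set set \<Rightarrow> bool" where
  "concentrates_on \<theta> I \<Gamma> \<longleftrightarrow> (\<exists>A\<subseteq>\<Gamma>. A \<in> dual_filter \<theta> I)"

definition completeness :: "'v::set_universe set set set \<Rightarrow> 'v \<Rightarrow> bool" where
  "completeness I \<mu> \<longleftrightarrow> Card \<mu> \<and>
     (\<forall>\<A>. \<A> \<subseteq> I \<and> \<A> \<prec> elts \<mu> \<longrightarrow> \<Union>\<A> \<in> I) \<and>
     (\<exists>\<A>. \<A> \<subseteq> I \<and> \<A> \<approx> elts \<mu> \<and> \<Union>\<A> \<notin> I)"

text \<open>
  The value of \<open>f\<close> at \<open>M \<inter> \<mu>\<close> is only meaningful if \<open>M \<inter> \<mu> \<in> \<mu>\<close>; this holds for all \<open>M\<close> in a set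
  from the dual filter, so the other \<open>M\<close> do not matter.
\<close>

definition bounds_completeness :: "'v::set_universe \<Rightarrow> 'v set set set \<Rightarrow> bool" where
  "bounds_completeness \<theta> I \<longleftrightarrow> (\<exists>\<mu>. completeness I \<mu> \<and> elts \<mu> \<subseteq> Hset \<theta> \<and>
     (\<forall>f \<in> elts \<mu> \<rightarrow> elts \<mu>.
        {M \<in> Zset \<theta>. f (the_set (M \<inter> elts \<mu>)) \<in> elts (otp {\<alpha> \<in> M. Ord \<alpha>})} \<in> dual_filter \<theta> I))"

end

theory Submission imports Defs begin

text \<open>
  Almost every \<open>M\<close> is closed under prescribed functions on \<open>H\<^sub>\<theta>\<close>, by fineness and normality, and
  the completeness is \<open>\<omega>\<^sub>2\<close>.  If for every \<open>\<delta> < \<omega>\<^sub>2\<close> the order types of \<open>M \<inter> ORD\<close>, for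
  such \<open>M\<close> with \<open>M \<inter> \<omega>\<^sub>2 = \<delta>\<close>, failed to be cofinal in \<open>\<omega>\<^sub>2\<close>, then a function
  \<open>f : \<omega>\<^sub>2 \<rightarrow> \<omega>\<^sub>2\<close> would contradict the bounding of the completeness.  So fix a \<open>\<delta>\<close>
  for which they are cofinal.

  Two facts about \<open>[\<omega>\<^sub>2]\<^sup>\<omega>\<close> are combined.  First, by reflection, if \<open>D\<^sub>\<zeta>\<close> contains a club in
  \<open>[\<zeta>]\<^sup>\<omega>\<close> for each \<open>\<zeta> < \<omega>\<^sub>2\<close>, then the union of the \<open>D\<^sub>\<zeta>\<close> contains a club in
  \<open>[\<omega>\<^sub>2]\<^sup>\<omega>\<close>.  Second, every club in \<open>[\<omega>\<^sub>2]\<^sup>\<omega>\<close> has continuum many members inside a single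
  countable set.  With \<open>D\<^sub>\<zeta>\<close> of size \<open>\<omega>\<^sub>1\<close> this gives that the continuum is at most \<open>\<omega>\<^sub>2\<close>,
  so that the countable subsets of \<open>\<omega>\<^sub>1\<close> can be enumerated by \<open>\<omega>\<^sub>2\<close> and those belonging to \<open>M\<close>
  are determined by \<open>M \<inter> \<omega>\<^sub>2\<close>.

  Now let \<open>D\<^sub>\<zeta>\<close> be the countable subsets of \<open>\<zeta>\<close> that lie in the collapse of some \<open>M\<close> with
  \<open>M \<inter> \<omega>\<^sub>2 = \<delta>\<close> and with collapse of height above \<open>\<zeta>\<close>; it contains a club since \<open>M\<close> is
  internally club.  Different \<open>M\<close> yield the same sets: within a common countable superset, a set is
  coded by the positions of its members, which form a countable subset of \<open>\<omega>\<^sub>1\<close>.  Since there are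
  only \<open>\<omega>\<^sub>1\<close> many codes with index below \<open>\<delta>\<close>, the second fact yields CH.  But then \<open>M\<close> contains
  all countable subsets of \<open>\<omega>\<^sub>1\<close>, so by the approximation property its collapse contains every
  subset of \<open>\<omega>\<^sub>1\<close>, although it has size \<open>\<omega>\<^sub>1\<close>.
\<close>

section \<open>Clubs and closure under finitary functions\<close>

text \<open>Arguments are lists and values are sets, so a single \<open>G\<close> with countable
  values stands for countably many finitary operations of all arities.\<close>

definition closed_under :: "('a list \<Rightarrow> 'a set) \<Rightarrow> 'a set \<Rightarrow> bool" where
  "closed_under G a \<longleftrightarrow> (\<forall>xs\<in>lists a. G xs \<subseteq> a)"

inductive_set cl :: "('a list \<Rightarrow> 'a set) \<Rightarrow> 'a set \<Rightarrow> 'a set" for G s where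
  base: "x \<in> s \<Longrightarrow> x \<in> cl G s"
| step: "xs \<in> lists (cl G s) \<Longrightarrow> y \<in> G xs \<Longrightarrow> y \<in> cl G s"

lemma subset_cl: "s \<subseteq> cl G s"
  by (auto intro: cl.base)

lemma closed_under_cl: "closed_under G (cl G s)"
  unfolding closed_under_def by (auto intro: cl.step)

lemma cl_subset:
  assumes "s \<subseteq> t" "closed_under G t"
  shows "cl G s \<subseteq> t"
proof
  fix x assume "x \<in> cl G s"
  then show "x \<in> t"
    by induction (use assms in \<open>auto simp: closed_under_def\<close>)
qed

lemma cl_mono: "s \<subseteq> t \<Longrightarrow> cl G s \<subseteq> cl G t"
  by (rule cl_subset) (auto intro: cl.base closed_under_cl)

lemma cl_finitary:
  assumes "x \<in> cl G s"
  obtains xs where "xs \<in> lists s" "x \<in> cl G (set xs)"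
proof -
  from assms have "\<exists>xs\<in>lists s. x \<in> cl G (set xs)"
  proof induction
    case (base x)
    then show ?case by (intro bexI[of _ "[x]"]) (auto intro: cl.base)
  next
    case (step xs y)
    from step(1) have "\<exists>zs\<in>lists s. set xs \<subseteq> cl G (set zs)"
    proof (induction xs)
      case Nil
      show ?case by (rule bexI[of _ "[]"]) auto
    next
      case (Cons x xs)
      then obtain zs us where "zs \<in> lists s" "set xs \<subseteq> cl G (set zs)"
        "us \<in> lists s" "x \<in> cl G (set us)" by auto
      then show ?case
        using cl_mono[of "set zs" "set (zs @ us)" G] cl_mono[of "set us" "set (zs @ us)" G]
        by (intro bexI[of _ "zs @ us"]) auto
    qed
    then obtain zs where zs: "zs \<in> lists s" "set xs \<subseteq> cl G (set zs)" by blast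
    then have "y \<in> cl G (set zs)" using step(2) by (intro cl.step[of xs]) auto
    then show ?case using zs by blast
  qed
  then show thesis using that by blast
qed

lemma countable_cl:
  assumes "\<And>xs. countable (G xs)" "countable s"
  shows "countable (cl G s)"
proof -
  define F where "F n = ((\<lambda>t. t \<union> (\<Union>xs\<in>lists t. G xs)) ^^ n) s" for n :: nat
  have F0: "F 0 = s" and FS: "F (Suc n) = F n \<union> (\<Union>xs\<in>lists (F n). G xs)" for n
    unfolding F_def by simp_all
  have cnt: "countable (F n)" for n
    by (induction n) (use assms in \<open>auto simp: F0 FS\<close>)
  have mono: "mono F" unfolding mono_iff_le_Suc FS by blast
  have "\<exists>n. set xs \<subseteq> F n" if "set xs \<subseteq> (\<Union>n. F n)" for xs
    using that
  proof (induction xs)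
    case (Cons x xs)
    then obtain m n where "set xs \<subseteq> F m" "x \<in> F n" by auto
    then have "set (x # xs) \<subseteq> F (max m n)"
      using monoD[OF mono, of m "max m n"] monoD[OF mono, of n "max m n"] by auto
    then show ?case by blast
  qed simp
  then have "closed_under G (\<Union>n. F n)"
    unfolding closed_under_def using FS by (fastforce simp: lists_eq_set)
  moreover have "s \<subseteq> (\<Union>n. F n)" using F0 by blast
  ultimately have "cl G s \<subseteq> (\<Union>n. F n)" by (rule cl_subset[rotated])
  then show ?thesis by (rule countable_subset) (simp add: cnt)
qed

lemma club_closed_sets:
  assumes "\<And>xs. countable (G xs)" "closed_under G X"
  shows "club X {a \<in> ctbl_subsets X. closed_under G a}"
proof -
  have "\<exists>c\<in>{a \<in> ctbl_subsets X. closed_under G a}. a \<subseteq> c" if "a \<in> ctbl_subsets X" for a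
    using that countable_cl[of G a] cl_subset[of a X G] assms
    by (intro bexI[of _ "cl G a"]) (auto simp: ctbl_subsets_def subset_cl closed_under_cl)
  moreover have "(\<Union>n. c n) \<in> {a \<in> ctbl_subsets X. closed_under G a}"
    if "range c \<subseteq> {a \<in> ctbl_subsets X. closed_under G a}" "mono c" for c :: "nat \<Rightarrow> 'a set"
  proof -
    have "\<exists>n. set xs \<subseteq> c n" if "set xs \<subseteq> (\<Union>n. c n)" for xs
      using that
    proof (induction xs)
      case (Cons x xs)
      then obtain m n where "set xs \<subseteq> c m" "x \<in> c n" by auto
      then have "set (x # xs) \<subseteq> c (max m n)"
        using monoD[OF \<open>mono c\<close>, of m "max m n"] monoD[OF \<open>mono c\<close>, of n "max m n"] by auto
      then show ?case by blast
    qed simp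
    moreover have "closed_under G (c n)" for n using that by blast
    ultimately have "closed_under G (\<Union>n. c n)"
      unfolding closed_under_def by (fastforce simp: lists_eq_set)
    then show ?thesis using that by (auto simp: ctbl_subsets_def)
  qed
  ultimately show ?thesis unfolding club_def by blast
qed

text \<open>\<open>G\<close> is chosen by recursion on the list: each value lies in \<open>C\<close>
  and contains the value at the tail together with the head. Along an enumeration of a nonempty
  closed set \<open>a\<close> these values form an increasing chain in \<open>C\<close> with union
  \<open>a\<close>.\<close>

lemma club_contains_closed_sets:
  assumes C: "club X C"
  obtains G where "\<And>xs. G xs \<in> ctbl_subsets X"
    "\<And>a. a \<in> ctbl_subsets X \<Longrightarrow> closed_under G a \<Longrightarrow> a \<in> C"
proof -
  have ex: "\<exists>c. c \<in> C \<and> a \<subseteq> c" if "a \<in> ctbl_subsets X" for a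
    using C that unfolding club_def by blast
  define G :: "'a list \<Rightarrow> 'a set" where
    "G = rec_list (SOME c. c \<in> C \<and> {} \<subseteq> c) (\<lambda>x _ c. SOME d. d \<in> C \<and> c \<union> ({x} \<inter> X) \<subseteq> d)"
  have CX: "c \<in> ctbl_subsets X" if "c \<in> C" for c using C that unfolding club_def by blast
  have GN: "G [] \<in> C"
    unfolding G_def using someI_ex[OF ex[of "{}"]] by (simp add: ctbl_subsets_def)
  have GC: "G (x # xs) \<in> C \<and> G xs \<union> ({x} \<inter> X) \<subseteq> G (x # xs)" if "G xs \<in> C" for x xs
  proof -
    have "G xs \<union> ({x} \<inter> X) \<in> ctbl_subsets X" using CX[OF that] by (auto simp: ctbl_subsets_def)
    from someI_ex[OF ex[OF this]] show ?thesis unfolding G_def by simp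
  qed
  have G: "G xs \<in> C" for xs by (induction xs) (use GN GC in auto)
  show thesis
  proof (rule that)
    show "G xs \<in> ctbl_subsets X" for xs using G CX by blast
    fix a assume a: "a \<in> ctbl_subsets X" "closed_under G a"
    show "a \<in> C"
    \<comment> \<open>The empty set has no enumeration; there closure makes \<open>G []\<close>
      empty, and \<open>G []\<close> lies in \<open>C\<close>.\<close>
    proof (cases "a = {}")
      case True
      then show ?thesis using a(2) GN unfolding closed_under_def by auto
    next
      case False
      define e where "e = from_nat_into a"
      have e: "range e = a"
        unfolding e_def using a(1) False by (intro range_from_nat_into) (auto simp: ctbl_subsets_def)
      \<comment> \<open>The reversal puts the newest element at the head, where the recursion for
        \<open>G\<close> adds it.\<close>
      define c where "c n = G (map e (rev [0..<n]))" for n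
      have S: "c (Suc n) = G (e n # map e (rev [0..<n]))" for n unfolding c_def by simp
      have "c n \<subseteq> c (Suc n)" for n
        unfolding S using GC[OF G, of "e n" "map e (rev [0..<n])"] by (simp add: c_def)
      then have "mono c" by (simp add: mono_iff_le_Suc)
      moreover have "range c \<subseteq> C" using G by (auto simp: c_def)
      ultimately have U: "(\<Union>n. c n) \<in> C" using C unfolding club_def by simp
      have "c n \<subseteq> a" for n
      proof -
        have "map e (rev [0..<n]) \<in> lists a" using e by auto
        then show ?thesis using a(2) by (simp add: closed_under_def c_def)
      qed
      moreover have "e n \<in> c (Suc n)" for n
        unfolding S using GC[OF G, of "e n" "map e (rev [0..<n])"] e a(1) by (auto simp: ctbl_subsets_def)
      ultimately have "(\<Union>n. c n) = a" using e by blast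
      then show ?thesis using U by simp
    qed
  qed
qed

text \<open>A countable set closed under the pointwise union of the two functions lies in both
  clubs.\<close>

lemma club_Int_cofinal:
  assumes "club X C" "club X D" "a \<in> ctbl_subsets X"
  obtains c where "c \<in> C" "c \<in> D" "a \<subseteq> c"
proof -
  obtain G where G: "\<And>xs. G xs \<in> ctbl_subsets X"
    "\<And>a. a \<in> ctbl_subsets X \<Longrightarrow> closed_under G a \<Longrightarrow> a \<in> C"
    by (rule club_contains_closed_sets[OF assms(1)]) blast
  obtain H where H: "\<And>xs. H xs \<in> ctbl_subsets X"
    "\<And>a. a \<in> ctbl_subsets X \<Longrightarrow> closed_under H a \<Longrightarrow> a \<in> D"
    by (rule club_contains_closed_sets[OF assms(2)]) blast
  let ?F = "\<lambda>xs. G xs \<union> H xs"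
  have "club X {a \<in> ctbl_subsets X. closed_under ?F a}"
    using G(1) H(1) by (intro club_closed_sets) (auto simp: ctbl_subsets_def closed_under_def)
  then obtain c where "a \<subseteq> c" "c \<in> ctbl_subsets X" "closed_under ?F c"
    using assms(3) unfolding club_def by blast
  then show thesis using that G(2)[of c] H(2)[of c] by (auto simp: closed_under_def)
qed

lemma stationary_Int_club:
  assumes "stationary X S" "club X D"
  shows "stationary X (S \<inter> D)"
  unfolding stationary_def
proof (intro conjI allI impI)
  show "S \<inter> D \<subseteq> ctbl_subsets X" using assms unfolding stationary_def by blast
  fix C assume "club X C"
  have "club X (C \<inter> D)"
    unfolding club_def
  proof (intro conjI ballI allI impI)
    show "C \<inter> D \<subseteq> ctbl_subsets X" using assms(2) unfolding club_def by blast
    show "\<exists>c\<in>C \<inter> D. a \<subseteq> c" if "a \<in> ctbl_subsets X" for a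
      using club_Int_cofinal[OF \<open>club X C\<close> assms(2) that] by blast
    show "(\<Union>n. c n) \<in> C \<inter> D" if "range c \<subseteq> C \<inter> D \<and> mono c" for c :: "nat \<Rightarrow> 'a set"
      using \<open>club X C\<close> assms(2) that unfolding club_def by simp
  qed
  then show "S \<inter> D \<inter> C \<noteq> {}" using assms(1) unfolding stationary_def by blast
qed

text \<open>Traces of a club on a subset again contain a club, here combined with a renaming
  \<open>h\<close> of the points. It later carries the internal club of a model to its
  collapse.\<close>

lemma club_project:
  assumes C: "club Y C" and XY: "X \<subseteq> Y" and h: "inj_on h X"
  obtains D where "club (h ` X) D" "D \<subseteq> (\<lambda>a. h ` (a \<inter> X)) ` C"
proof -
  obtain G where G: "\<And>xs. G xs \<in> ctbl_subsets Y"
    "\<And>a. a \<in> ctbl_subsets Y \<Longrightarrow> closed_under G a \<Longrightarrow> a \<in> C"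
    by (rule club_contains_closed_sets[OF C]) blast
  have Gc: "countable (G xs)" for xs using G(1)[of xs] by (auto simp: ctbl_subsets_def)
  have GY: "closed_under G Y" using G(1) by (auto simp: ctbl_subsets_def closed_under_def)
  define k where "k = the_inv_into X h"
  have k: "k (h x) = x" if "x \<in> X" for x unfolding k_def using the_inv_into_f_f[OF h that] .
  \<comment> \<open>Each element of a closure depends on finitely many generators. So a set closed
    under \<open>H\<close> absorbs the whole trace on \<open>X\<close> of the
    \<open>G\<close>-closure of its preimage.\<close>
  define H where "H ys = h ` (cl G (set (map k ys)) \<inter> X)" for ys
  have Hc: "countable (H ys)" for ys
    unfolding H_def by (intro countable_image countable_Int1 countable_cl Gc countable_finite) simp
  have HX: "closed_under H (h ` X)" unfolding closed_under_def H_def by blast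
  have "b \<in> (\<lambda>a. h ` (a \<inter> X)) ` C" if b: "b \<in> ctbl_subsets (h ` X)" "closed_under H b" for b
  proof -
    define a where "a = cl G (k ` b)"
    have bX: "b \<subseteq> h ` X" using b(1) by (auto simp: ctbl_subsets_def)
    then have kb: "k ` b \<subseteq> X" using k by auto
    have "countable a" unfolding a_def
      by (rule countable_cl[OF Gc]) (use b(1) in \<open>auto simp: ctbl_subsets_def\<close>)
    moreover have "a \<subseteq> Y" unfolding a_def using kb XY GY by (intro cl_subset) auto
    ultimately have "a \<in> C" by (intro G(2)) (auto simp: ctbl_subsets_def a_def closed_under_cl)
    moreover have "b = h ` (a \<inter> X)"
    proof
      show "b \<subseteq> h ` (a \<inter> X)"
      proof
        fix y assume y: "y \<in> b"
        then obtain x where x: "x \<in> X" "y = h x" using bX by blast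
        then have "x \<in> k ` b" using y k by force
        then show "y \<in> h ` (a \<inter> X)" using x unfolding a_def by (auto intro: cl.base)
      qed
      show "h ` (a \<inter> X) \<subseteq> b"
      proof
        fix y assume "y \<in> h ` (a \<inter> X)"
        then obtain x where x: "x \<in> X" "x \<in> a" "y = h x" by blast
        obtain xs where xs: "xs \<in> lists (k ` b)" "x \<in> cl G (set xs)"
          using cl_finitary[OF x(2)[unfolded a_def]] by blast
        have "k (h z) = z" if "z \<in> set xs" for z
          using that xs(1) kb by (intro k) (auto simp: lists_eq_set)
        then have "map k (map h xs) = xs" by (auto intro!: map_idI)
        then have "y \<in> H (map h xs)" unfolding H_def using x xs(2) by auto
        moreover have "map h xs \<in> lists b"
          using xs(1) bX k by (force simp: lists_eq_set)
        ultimately show "y \<in> b" using b(2) unfolding closed_under_def by blast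
      qed
    qed
    ultimately show ?thesis by blast
  qed
  then show thesis using that[OF club_closed_sets[OF Hc HX]] by blast
qed

section \<open>Ordinals below omega2\<close>

lemma lepoll_or_lesspoll:
  fixes A :: "'a set" and B :: "'b set"
  shows "A \<lesssim> B \<or> B \<prec> A"
proof -
  have "A \<lesssim> B \<or> B \<lesssim> A"
    using ordLeq_total[OF card_of_Well_order card_of_Well_order, of A B]
    unfolding lepoll_def card_of_ordLeq .
  then show ?thesis
    using eqpoll_imp_lepoll[OF eqpoll_sym, of B A] unfolding lesspoll_def by auto
qed

lemma not_lesspoll_self: "\<not> A \<prec> A"
  by (simp add: lesspoll_def)

lemma elts_the_set_subset:
  fixes x :: "'v::set_universe"
  shows "A \<subseteq> elts x \<Longrightarrow> elts (the_set A) = A"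
  using elts_the_set[of A x id] by simp

lemma Ord_mem_trans: "Ord \<alpha> \<Longrightarrow> \<beta> \<in> elts \<alpha> \<Longrightarrow> \<gamma> \<in> elts \<beta> \<Longrightarrow> \<gamma> \<in> elts \<alpha>"
  unfolding Ord_def transitive_def by blast

lemma Ord_not_mem_imp_subset: "Ord \<alpha> \<Longrightarrow> Ord \<beta> \<Longrightarrow> \<alpha> \<notin> elts \<beta> \<Longrightarrow> elts \<beta> \<subseteq> elts \<alpha>"
  using Ord_linear[of \<alpha> \<beta>] Ord_mem_trans[of \<alpha> \<beta>] by blast

lemma transitive_subset_Ord:
  fixes \<alpha> :: "'v::set_universe"
  assumes "Ord \<alpha>" "A \<subseteq> elts \<alpha>" "transitive A"
  obtains \<beta> where "Ord \<beta>" "elts \<beta> = A" "\<beta> = \<alpha> \<or> \<beta> \<in> elts \<alpha>"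
proof -
  have e: "elts (the_set A) = A" by (rule elts_the_set_subset[OF assms(2)])
  have O: "Ord (the_set A)"
    unfolding Ord_def e using assms Ord_member[OF assms(1)] unfolding Ord_def by blast
  have "\<alpha> \<notin> A" using assms(2) mem_irrefl by blast
  then show thesis using that[OF O e] Ord_linear[OF O assms(1)] e by blast
qed

lemma mem_omega1: "Ord \<alpha> \<Longrightarrow> countable (elts \<alpha>) \<Longrightarrow> \<alpha> \<in> elts omega1"
  using Ord_not_mem_imp_subset[OF _ omega1(1)] omega1(2) countable_subset by blast

lemma mem_omega2:
  assumes "Ord (\<alpha> :: 'v::set_universe)" "elts \<alpha> \<lesssim> elts (omega1 :: 'v)"
  shows "\<alpha> \<in> elts omega2"
proof (rule ccontr)
  assume "\<alpha> \<notin> elts omega2"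
  then have "elts (omega2 :: 'v) \<subseteq> elts \<alpha>" by (rule Ord_not_mem_imp_subset[OF assms(1) omega2(1)])
  then have "elts (omega2 :: 'v) \<lesssim> elts (omega1 :: 'v)"
    using assms(2) by (meson lepoll_trans subset_imp_lepoll)
  then show False using omega2(2) lesspoll_trans1 not_lesspoll_self by blast
qed

lemma omega1_mem_omega2: "(omega1 :: 'v::set_universe) \<in> elts omega2"
  by (rule mem_omega2[OF omega1(1)]) simp

lemma omega1_subset_omega2: "elts (omega1 :: 'v::set_universe) \<subseteq> elts omega2"
  using Ord_mem_trans[OF omega2(1) omega1_mem_omega2] by blast

lemma infinite_omega1: "infinite (elts (omega1 :: 'v::set_universe))"
  using omega1(2) countable_finite by blast

lemma infinite_omega2: "infinite (elts (omega2 :: 'v::set_universe))"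
  using infinite_omega1 omega1_subset_omega2 finite_subset by blast

lemma omega1_lepoll_uncountable:
  fixes A :: "'a set"
  assumes "uncountable A"
  shows "elts (omega1 :: 'v::set_universe) \<lesssim> A"
proof (rule ccontr)
  assume n: "\<not> ?thesis"
  then have A: "A \<prec> elts (omega1 :: 'v)" using lepoll_or_lesspoll by blast
  \<comment> \<open>The members of \<open>A\<close> are arbitrary objects; only the injection into
    \<open>omega1\<close> yields a set of the universe of the same size, and with it an
    ordinal.\<close>
  then obtain f :: "'a \<Rightarrow> 'v" where f: "inj_on f A" "f ` A \<subseteq> elts omega1"
    unfolding lesspoll_def lepoll_def by blast
  obtain x :: 'v where x: "elts x = f ` A" using elts_the_set_subset[OF f(2)] by blast
  obtain \<alpha> :: 'v where \<alpha>: "Ord \<alpha>" "elts \<alpha> \<approx> elts x" by (rule Ord_eqpoll[of x])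
  have eq: "elts \<alpha> \<approx> A"
    using \<alpha>(2) eqpoll_sym[OF inj_on_image_eqpoll_self[OF f(1)]] x eqpoll_trans
    by (metis inj_on_image_eqpoll_self f(1))
  then have "uncountable (elts \<alpha>)" using assms countable_eqpoll eqpoll_sym by blast
  then have "elts (omega1 :: 'v) \<subseteq> elts \<alpha>"
    using Ord_not_mem_imp_subset[OF \<alpha>(1) omega1(1)] omega1(3) by blast
  then have "elts (omega1 :: 'v) \<lesssim> A" using eq by (meson lepoll_trans2 subset_imp_lepoll)
  then show False using n by blast
qed

lemma UN_lepoll:
  assumes "infinite B" "I \<lesssim> B" "\<And>i. i \<in> I \<Longrightarrow> A i \<lesssim> B"
  shows "(\<Union>i\<in>I. A i) \<lesssim> B"
  using assms card_of_UNION_ordLeq_infinite[of B I A]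
  unfolding lepoll_def card_of_ordLeq by blast

lemma insert_lepoll_infinite:
  assumes "infinite B" "A \<lesssim> B"
  shows "insert x A \<lesssim> B"
proof (cases "finite A")
  case True
  then show ?thesis using finite_lepoll_infinite[OF assms(1), of "insert x A"] by simp
next
  case False
  then have "insert x A \<lesssim> A" by (rule infinite_insert_lepoll)
  then show ?thesis using assms(2) by (rule lepoll_trans)
qed

text \<open>Regularity of \<open>omega2\<close>: the ordinals together with all their members form
  an ordinal of size at most \<open>omega1\<close>.\<close>

lemma omega2_bounded:
  fixes \<gamma> :: "'b \<Rightarrow> 'v::set_universe"
  assumes "I \<lesssim> elts (omega1 :: 'v)" "\<And>i. i \<in> I \<Longrightarrow> \<gamma> i \<in> elts omega2"
  obtains \<beta> where "\<beta> \<in> elts omega2" "\<And>i. i \<in> I \<Longrightarrow> \<gamma> i \<in> elts \<beta>"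
proof -
  let ?B = "\<Union>i\<in>I. insert (\<gamma> i) (elts (\<gamma> i))"
  have le: "?B \<lesssim> elts (omega1 :: 'v)"
    by (rule UN_lepoll[OF infinite_omega1 assms(1)] insert_lepoll_infinite infinite_omega1 omega2(3) assms(2))+
  have "transitive ?B"
    unfolding transitive_def using assms(2) Ord_member[OF omega2(1)] Ord_mem_trans by blast
  moreover have "?B \<subseteq> elts omega2" using assms(2) Ord_mem_trans[OF omega2(1)] by blast
  ultimately obtain \<beta> where \<beta>: "Ord \<beta>" "elts \<beta> = ?B" using transitive_subset_Ord[OF omega2(1)] by metis
  then have "\<beta> \<in> elts omega2" using le by (intro mem_omega2) auto
  then show thesis using \<beta> by (intro that) auto
qed

text \<open>\<open>card\<close> is strictly monotone along membership in \<open>omega\<close>, hence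
  injective there. This turns countability in the sense of a model into actual countability.\<close>

lemma countable_omega: "countable (elts (omega :: 'v::set_universe))"
proof -
  let ?Q = "\<lambda>\<alpha>::'v. Ord \<alpha> \<and> infinite (elts \<alpha>) \<and> (\<forall>\<beta>\<in>elts \<alpha>. finite (elts \<beta>))"
  have "Ord (omega1 :: 'v) \<and> infinite (elts (omega1 :: 'v))" using omega1(1) infinite_omega1 by blast
  then obtain m :: 'v where m: "Ord m \<and> infinite (elts m)"
    "\<And>y. y \<in> elts m \<Longrightarrow> \<not> (Ord y \<and> infinite (elts y))"
    by (rule mem_minimal[where P = "\<lambda>a. Ord a \<and> infinite (elts a)"]) (rule that)
  have Q: "?Q m" using m(1) m(2) Ord_member[of m] by auto
  moreover have "\<alpha> = m" if "?Q \<alpha>" for \<alpha>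
    using that Q Ord_linear[of \<alpha> m] by auto
  ultimately have Q: "?Q omega" unfolding omega_def by (rule theI)
  have less: "card (elts \<beta>) < card (elts \<gamma>)" if "\<beta> \<in> elts \<gamma>" "\<gamma> \<in> elts omega" for \<beta> \<gamma> :: 'v
  proof (rule psubset_card_mono)
    show "finite (elts \<gamma>)" using Q that(2) by blast
    show "elts \<beta> \<subset> elts \<gamma>"
      using that mem_irrefl[of \<beta>] Ord_mem_trans[OF Ord_member[of omega \<gamma>]] Q by blast
  qed
  have "inj_on (\<lambda>\<beta>. card (elts \<beta>)) (elts (omega :: 'v))"
  proof (rule inj_onI)
    fix \<beta> \<gamma> :: 'v
    assume "\<beta> \<in> elts omega" "\<gamma> \<in> elts omega" "card (elts \<beta>) = card (elts \<gamma>)"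
    then show "\<beta> = \<gamma>"
      using less[of \<beta> \<gamma>] less[of \<gamma> \<beta>] Ord_linear[of \<beta> \<gamma>] Ord_member Q by auto
  qed
  then show ?thesis by (rule countableI')
qed

section \<open>Collapses of sets of ordinals\<close>

lemma elts_collapse:
  fixes x :: "'v::set_universe"
  shows "elts (collapse A x) = collapse A ` (elts x \<inter> A)"
  unfolding collapse.simps[of A x] by (rule elts_the_set[of _ x]) simp

lemma Ord_collapse:
  fixes \<alpha> :: "'v::set_universe"
  shows "Ord \<alpha> \<Longrightarrow> Ord (collapse A \<alpha>)"
proof (induction \<alpha> rule: mem_induct)
  case (1 \<alpha>)
  then have "transitive (elts (collapse A \<beta>))" if "\<beta> \<in> elts \<alpha>" for \<beta>
    using that Ord_member unfolding Ord_def by blast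
  moreover have "transitive (elts (collapse A \<alpha>))"
    unfolding transitive_def elts_collapse using 1(2) by (fastforce simp: elts_collapse dest: Ord_mem_trans)
  ultimately show ?case unfolding Ord_def by (auto simp: elts_collapse)
qed

lemma collapse_mem_iff:
  fixes \<alpha> \<beta> :: "'v::set_universe"
  assumes "Ord \<alpha>" "Ord \<beta>" "\<alpha> \<in> A" "\<beta> \<in> A"
  shows "collapse A \<alpha> \<in> elts (collapse A \<beta>) \<longleftrightarrow> \<alpha> \<in> elts \<beta>"
proof -
  have up: "collapse A \<alpha> \<in> elts (collapse A \<beta>)" if "\<alpha> \<in> A" "\<alpha> \<in> elts \<beta>" for \<alpha> \<beta>
    using that by (auto simp: elts_collapse)
  have "\<not> collapse A \<alpha> \<in> elts (collapse A \<beta>)" if "\<beta> \<in> elts \<alpha> \<or> \<alpha> = \<beta>"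
    using that up[of \<beta> \<alpha>] assms mem_irrefl Ord_mem_trans[OF Ord_collapse[OF assms(1)]] by metis
  then show ?thesis using up Ord_linear assms by blast
qed

lemma inj_on_collapse:
  fixes A :: "'v::set_universe set"
  assumes "\<And>\<alpha>. \<alpha> \<in> A \<Longrightarrow> Ord \<alpha>"
  shows "inj_on (collapse A) A"
proof (rule inj_onI)
  fix \<alpha> \<beta> assume "\<alpha> \<in> A" "\<beta> \<in> A" "collapse A \<alpha> = collapse A \<beta>"
  then show "\<alpha> = \<beta>"
    using Ord_linear[of \<alpha> \<beta>] assms collapse_mem_iff[of \<alpha> \<beta> A] collapse_mem_iff[of \<beta> \<alpha> A] mem_irrefl
    by metis
qed

text \<open>The position of a member in a set is invariant under order isomorphisms. Therefore codes
  computed in a model and in its collapse agree.\<close>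

lemma collapse_image:
  fixes \<beta> :: "'v::set_universe"
  assumes "\<And>\<alpha> \<beta>. \<alpha> \<in> x \<Longrightarrow> \<beta> \<in> x \<Longrightarrow> \<pi> \<alpha> \<in> elts (\<pi> \<beta>) \<longleftrightarrow> \<alpha> \<in> elts \<beta>"
  shows "\<beta> \<in> x \<Longrightarrow> collapse (\<pi> ` x) (\<pi> \<beta>) = collapse x \<beta>"
proof (induction \<beta> rule: mem_induct)
  case (1 \<beta>)
  have "elts (\<pi> \<beta>) \<inter> \<pi> ` x = \<pi> ` (elts \<beta> \<inter> x)" using assms 1(2) by blast
  then have "collapse (\<pi> ` x) ` (elts (\<pi> \<beta>) \<inter> \<pi> ` x) = collapse x ` (elts \<beta> \<inter> x)"
    using 1(1) by (auto simp: image_image intro!: image_cong)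
  then show ?case by (intro extensionality) (simp only: elts_collapse)
qed

lemma collapse_mem_omega1:
  fixes \<beta> :: "'v::set_universe"
  assumes "Ord \<beta>" "countable x"
  shows "collapse x \<beta> \<in> elts omega1"
  by (rule mem_omega1[OF Ord_collapse[OF assms(1)]]) (simp add: elts_collapse assms(2))

text \<open>The collapse is the required isomorphism, and induction on membership shows that any
  other one agrees with it. The bound \<open>x\<close> makes the image a set of the
  universe.\<close>

lemma elts_otp:
  fixes A :: "'v::set_universe set"
  assumes Ord: "\<And>\<alpha>. \<alpha> \<in> A \<Longrightarrow> Ord \<alpha>" and small: "A \<subseteq> elts x"
  shows "elts (otp A) = collapse A ` A"
proof -
  let ?P = "\<lambda>\<alpha>. Ord \<alpha> \<and>
    (\<exists>h. bij_betw h A (elts \<alpha>) \<and> (\<forall>x\<in>A. \<forall>y\<in>A. x \<in> elts y \<longleftrightarrow> h x \<in> elts (h y)))"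
  define \<tau> where "\<tau> = the_set (collapse A ` A)"
  have \<tau>: "elts \<tau> = collapse A ` A" unfolding \<tau>_def by (rule elts_the_set[OF small])
  have tr: "transitive (collapse A ` A)" unfolding transitive_def by (auto simp: elts_collapse)
  have "transitive (elts (collapse A \<alpha>))" if "\<alpha> \<in> A" for \<alpha>
    using Ord_collapse[OF Ord[OF that]] unfolding Ord_def by blast
  then have "Ord \<tau>" unfolding Ord_def \<tau> using tr by blast
  moreover have "bij_betw (collapse A) A (elts \<tau>)"
    using inj_on_collapse[of A] Ord by (simp add: bij_betw_def \<tau>)
  moreover have "\<forall>x\<in>A. \<forall>y\<in>A. x \<in> elts y \<longleftrightarrow> collapse A x \<in> elts (collapse A y)"
    using Ord collapse_mem_iff by blast
  ultimately have P: "?P \<tau>" by blast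
  have "\<alpha> = \<tau>" if \<alpha>: "?P \<alpha>" for \<alpha>
  proof -
    obtain h where h: "bij_betw h A (elts \<alpha>)" "\<forall>x\<in>A. \<forall>y\<in>A. x \<in> elts y \<longleftrightarrow> h x \<in> elts (h y)"
      using \<alpha> by blast
    have "h \<beta> = collapse A \<beta>" if "\<beta> \<in> A" for \<beta>
      using that
    proof (induction \<beta> rule: mem_induct)
      case (1 \<beta>)
      have "elts (h \<beta>) \<subseteq> h ` A"
        using bij_betw_imp_surj_on[OF h(1)] 1(2) Ord_mem_trans[OF conjunct1[OF \<alpha>]] by blast
      then have "elts (h \<beta>) = h ` (elts \<beta> \<inter> A)" using h(2) 1(2) by blast
      also have "\<dots> = elts (collapse A \<beta>)"
        unfolding elts_collapse by (rule image_cong) (use 1(1) in auto)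
      finally show ?case by (rule extensionality)
    qed
    then have "elts \<alpha> = elts \<tau>"
      unfolding \<tau> bij_betw_imp_surj_on[OF h(1), symmetric] by (rule image_cong[OF refl])
    then show ?thesis by (rule extensionality)
  qed
  with P have "otp A = \<tau>" unfolding otp_def by (rule the_equality)
  then show ?thesis using \<tau> by simp
qed

section \<open>Reflection and clubs in omega2\<close>

text \<open>With these choices an ordinal below \<open>\<alpha>\<close> is recoverable from
  \<open>\<alpha>\<close> and a countable ordinal. The value is meaningful only for
  \<open>\<alpha>\<close> below \<open>omega2\<close>.\<close>

definition iota :: "'v::set_universe \<Rightarrow> 'v \<Rightarrow> 'v" where
  "iota \<alpha> = (SOME f. inj_on f (elts \<alpha>) \<and> f ` elts \<alpha> \<subseteq> elts omega1)"

lemma iota: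
  assumes "\<alpha> \<in> elts (omega2 :: 'v::set_universe)"
  shows "inj_on (iota \<alpha>) (elts \<alpha>)" "\<beta> \<in> elts \<alpha> \<Longrightarrow> iota \<alpha> \<beta> \<in> elts omega1"
proof -
  have "\<exists>f. inj_on f (elts \<alpha>) \<and> f ` elts \<alpha> \<subseteq> elts (omega1 :: 'v)"
    using omega2(3)[OF assms] unfolding lepoll_def .
  from someI_ex[OF this] show "inj_on (iota \<alpha>) (elts \<alpha>)" "\<beta> \<in> elts \<alpha> \<Longrightarrow> iota \<alpha> \<beta> \<in> elts omega1"
    unfolding iota_def by blast+
qed

lemma stationary_superset:
  assumes S: "stationary X S" and b: "b \<in> ctbl_subsets X"
  obtains a where "a \<in> S" "b \<subseteq> a"
proof -
  have "club X {a \<in> ctbl_subsets X. closed_under (\<lambda>_. b) a}"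
    using b by (intro club_closed_sets) (auto simp: ctbl_subsets_def closed_under_def)
  then obtain a where "a \<in> S" "closed_under (\<lambda>_. b) a" using S unfolding stationary_def by blast
  then show thesis using that by (auto simp: closed_under_def)
qed

text \<open>If the complement \<open>S\<close> of the union were stationary, it would reflect to
  some \<open>X\<close>. Closure under inverses of \<open>iota\<close> makes \<open>X\<close> an
  ordinal \<open>\<eta>\<close> below \<open>omega2\<close>, and the club inside
  \<open>D \<eta>\<close> misses \<open>S\<close>.\<close>

lemma RP_union_contains_club:
  fixes D :: "'v::set_universe \<Rightarrow> 'v set set"
  assumes RP: "RP (omega2 :: 'v)"
    and D: "\<And>\<eta>. \<eta> \<in> elts omega2 \<Longrightarrow> \<exists>C. club (elts \<eta>) C \<and> C \<subseteq> D \<eta>"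
  obtains C where "club (elts omega2) C" "C \<subseteq> (\<Union>\<eta>\<in>elts omega2. D \<eta>)"
proof -
  define S where "S = ctbl_subsets (elts omega2) - (\<Union>\<eta>\<in>elts omega2. D \<eta>)"
  have "\<not> stationary (elts omega2) S"
  proof
    assume S: "stationary (elts omega2) S"
    define G :: "'v list \<Rightarrow> 'v set" where
      "G xs = (\<Union>\<alpha>\<in>set xs \<inter> elts omega2. \<Union>i\<in>set xs. {\<beta> \<in> elts \<alpha>. iota \<alpha> \<beta> = i})" for xs
    have "countable {\<beta> \<in> elts \<alpha>. iota \<alpha> \<beta> = i}" if "\<alpha> \<in> elts omega2" for \<alpha> i :: 'v
    proof -
      have "{\<beta> \<in> elts \<alpha>. iota \<alpha> \<beta> = i} \<subseteq> {inv_into (elts \<alpha>) (iota \<alpha>) i}"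
        using inv_into_f_f[OF iota(1)[OF that]] by auto
      then show ?thesis by (rule countable_subset) simp
    qed
    then have "countable (G xs)" for xs
      unfolding G_def by (intro countable_UN countable_Int1) (auto intro: countable_finite)
    moreover have "closed_under G (elts omega2)"
      unfolding closed_under_def G_def using Ord_mem_trans[OF omega2(1)] by blast
    ultimately have K: "club (elts omega2) {a \<in> ctbl_subsets (elts omega2). closed_under G a}"
      (is "club _ ?K") by (rule club_closed_sets)
    obtain X :: "'v set" where X: "X \<subseteq> elts omega2" "elts omega1 \<subseteq> X" "X \<approx> elts (omega1 :: 'v)"
      "stationary X (S \<inter> ?K \<inter> ctbl_subsets X)"
      using RP[unfolded RP_def, rule_format, OF stationary_Int_club[OF S K]] by auto
    \<comment> \<open>Since \<open>X\<close> contains \<open>omega1\<close>, both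
      \<open>\<alpha>\<close> and \<open>iota \<alpha> \<beta>\<close> are in \<open>X\<close>. Some
      \<open>G\<close>-closed subset of \<open>X\<close> contains both, hence also
      \<open>\<beta>\<close>.\<close>
    have "\<beta> \<in> X" if \<alpha>: "\<alpha> \<in> X" "\<beta> \<in> elts \<alpha>" for \<alpha> \<beta>
    proof -
      have i: "iota \<alpha> \<beta> \<in> X" using iota(2)[of \<alpha> \<beta>] X(1,2) \<alpha> by blast
      have "{\<alpha>, iota \<alpha> \<beta>} \<in> ctbl_subsets X" using i \<alpha>(1) by (simp add: ctbl_subsets_def)
      from stationary_superset[OF X(4) this] obtain a where
        a: "a \<in> ctbl_subsets X" "\<alpha> \<in> a" "iota \<alpha> \<beta> \<in> a" "closed_under G a" by auto
      have "\<beta> \<in> G [\<alpha>, iota \<alpha> \<beta>]" unfolding G_def using \<alpha> X(1) by auto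
      then have "\<beta> \<in> a" using a unfolding closed_under_def by (auto dest: bspec[of _ _ "[\<alpha>, iota \<alpha> \<beta>]"])
      then show ?thesis using a(1) by (auto simp: ctbl_subsets_def)
    qed
    then have "transitive X" unfolding transitive_def by blast
    then obtain \<eta> where \<eta>: "Ord \<eta>" "elts \<eta> = X"
      using transitive_subset_Ord[OF omega2(1) X(1)] by metis
    have \<eta>2: "\<eta> \<in> elts omega2"
      using mem_omega2[OF \<eta>(1)] \<eta>(2) X(3) eqpoll_imp_lepoll by blast
    then obtain C where "club X C" "C \<subseteq> D \<eta>" using D \<eta>(2) by blast
    then obtain a where "a \<in> S" "a \<in> D \<eta>" using X(4) unfolding stationary_def by blast
    then show False using \<eta>2 unfolding S_def by blast
  qed
  then obtain C where C: "club (elts omega2) C" "S \<inter> C = {}"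
    unfolding stationary_def S_def by blast
  have "C \<subseteq> ctbl_subsets (elts omega2)" using C(1) by (simp add: club_def)
  then have "C \<subseteq> (\<Union>\<eta>\<in>elts omega2. D \<eta>)" using C(2) unfolding S_def by blast
  with C(1) show thesis by (rule that)
qed

section \<open>Many subsets of a countable set in a club\<close>

primrec play :: "(nat \<Rightarrow> 'a) \<Rightarrow> 'a list \<Rightarrow> nat \<Rightarrow> 'a list" where
  "play \<alpha> p 0 = p"
| "play \<alpha> p (Suc n) = \<alpha> n # play \<alpha> p n"

lemma length_play: "length (play \<alpha> p n) = n + length p"
  by (induction n) auto

lemma play_shift: "play (\<alpha> \<circ> Suc) (\<alpha> 0 # p) n = play \<alpha> p (Suc n)"
  by (induction n) auto

lemma nth_play: "play \<alpha> p (Suc n) ! n = \<alpha> 0"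
  by (induction n) auto

lemma set_play: "set (play \<alpha> p n) = \<alpha> ` {..<n} \<union> set p"
  by (induction n) (auto simp: lessThan_Suc)

text \<open>
  In the game on \<open>\<omega>\<^sub>2\<close> the opponent names bounds, each of which is answered by a larger ordinal;
  the opponent wins if some position violates \<open>ok\<close>.  A position is lost if the opponent has a
  winning strategy \<open>\<sigma>\<close>.
\<close>

definition lost :: "('v::set_universe list \<Rightarrow> bool) \<Rightarrow> 'v list \<Rightarrow> bool" where
  "lost ok p \<longleftrightarrow> (\<exists>\<sigma>. (\<forall>q. \<sigma> q \<in> elts omega2) \<and>
     (\<forall>\<alpha>. (\<forall>n. \<alpha> n \<in> elts omega2 \<and> \<sigma> (play \<alpha> p n) \<in> elts (\<alpha> n)) \<longrightarrow> (\<exists>n. \<not> ok (play \<alpha> p n))))"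

text \<open>A position violating \<open>ok\<close> is won by every strategy after no further move,
  in particular by the constant one with value \<open>omega1\<close>.\<close>

lemma not_lost_ok: "\<not> lost ok p \<Longrightarrow> ok (p :: 'v::set_universe list)"
  unfolding lost_def
  by (erule contrapos_np, rule exI[of _ "\<lambda>_. omega1"]) (auto simp: omega1_mem_omega2 intro!: exI[of _ 0])

text \<open>Otherwise the opponent names \<open>\<gamma>\<close> first and continues, after each
  answer \<open>\<beta>\<close>, with a winning strategy from \<open>\<beta> # p\<close>. Glued
  together, these win from \<open>p\<close>.\<close>

lemma not_lost_step:
  fixes p :: "'v::set_universe list"
  assumes p: "\<not> lost ok p" and \<gamma>: "\<gamma> \<in> elts omega2"
  obtains \<beta> where "\<beta> \<in> elts omega2" "\<gamma> \<in> elts \<beta>" "\<not> lost ok (\<beta> # p)"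
proof (rule ccontr)
  note goal = that
  assume n: "\<not> thesis"
  define \<sigma> where "\<sigma> \<beta> = (SOME \<sigma>. (\<forall>q. \<sigma> q \<in> elts omega2) \<and>
     (\<forall>\<alpha>. (\<forall>n. \<alpha> n \<in> elts omega2 \<and> \<sigma> (play \<alpha> (\<beta> # p) n) \<in> elts (\<alpha> n)) \<longrightarrow>
        (\<exists>n. \<not> ok (play \<alpha> (\<beta> # p) n))))" for \<beta> :: 'v
  \<comment> \<open>Moves are added at the head, so this index finds the first answer after
    \<open>p\<close>. The value \<open>\<gamma>\<close> is the opening bound and also the default at
    illegal positions.\<close>
  define \<tau> where "\<tau> q = (let \<beta> = q ! (length q - length p - 1) in
    if length q \<le> length p \<or> \<beta> \<notin> elts omega2 \<or> \<gamma> \<notin> elts \<beta> then \<gamma> else \<sigma> \<beta> q)" for q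
  have \<sigma>: "(\<forall>q. \<sigma> \<beta> q \<in> elts omega2) \<and>
     (\<forall>\<alpha>. (\<forall>n. \<alpha> n \<in> elts omega2 \<and> \<sigma> \<beta> (play \<alpha> (\<beta> # p) n) \<in> elts (\<alpha> n)) \<longrightarrow>
        (\<exists>n. \<not> ok (play \<alpha> (\<beta> # p) n)))"
    if "\<beta> \<in> elts omega2" "\<gamma> \<in> elts \<beta>" for \<beta>
  proof -
    have "lost ok (\<beta> # p)" using n goal that by blast
    then show ?thesis unfolding lost_def \<sigma>_def by (rule someI_ex)
  qed
  have "\<tau> q \<in> elts omega2" for q unfolding \<tau>_def Let_def using \<sigma> \<gamma> by simp
  moreover have "\<exists>n. \<not> ok (play \<alpha> p n)"
    if \<alpha>: "\<And>n. \<alpha> n \<in> elts omega2 \<and> \<tau> (play \<alpha> p n) \<in> elts (\<alpha> n)" for \<alpha>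
  proof -
    have 0: "\<alpha> 0 \<in> elts omega2" "\<gamma> \<in> elts (\<alpha> 0)" using \<alpha>[of 0] by (auto simp: \<tau>_def Let_def)
    have "\<tau> (play \<alpha> p (Suc n)) = \<sigma> (\<alpha> 0) (play \<alpha> p (Suc n))" for n
      unfolding \<tau>_def using 0 nth_play[of \<alpha> p n] by (simp add: length_play Let_def del: play.simps)
    then have "\<forall>n. (\<alpha> \<circ> Suc) n \<in> elts omega2 \<and>
        \<sigma> (\<alpha> 0) (play (\<alpha> \<circ> Suc) (\<alpha> 0 # p) n) \<in> elts ((\<alpha> \<circ> Suc) n)"
      using \<alpha> unfolding play_shift comp_apply by metis
    then have "\<exists>n. \<not> ok (play (\<alpha> \<circ> Suc) (\<alpha> 0 # p) n)" using \<sigma>[OF 0] by blast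
    then show ?thesis unfolding play_shift by blast
  qed
  ultimately show False using p unfolding lost_def by blast
qed

text \<open>By regularity of \<open>\<omega>\<^sub>2\<close>, a single sequence of ordinals beats \<open>\<omega>\<^sub>1\<close> many strategies at once.\<close>

lemma ex_not_lost:
  fixes ok :: "'v::set_universe \<Rightarrow> 'v list \<Rightarrow> bool"
  assumes "\<And>\<alpha>. range \<alpha> \<subseteq> elts omega2 \<Longrightarrow> \<exists>i\<in>elts omega1. \<forall>n. ok i (play \<alpha> [] n)"
  obtains i where "i \<in> elts omega1" "\<not> lost (ok i) []"
proof (rule ccontr)
  assume "\<not> thesis"
  then have "\<forall>i\<in>elts omega1. lost (ok i) []" using that by blast
  then obtain \<sigma> where \<sigma>: "\<And>i q. i \<in> elts omega1 \<Longrightarrow> \<sigma> i q \<in> elts omega2"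
    "\<And>i \<alpha>. i \<in> elts omega1 \<Longrightarrow> \<forall>n. \<alpha> n \<in> elts omega2 \<and> \<sigma> i (play \<alpha> [] n) \<in> elts (\<alpha> n) \<Longrightarrow>
      \<exists>n. \<not> ok i (play \<alpha> [] n)"
    unfolding lost_def by metis
  have "\<exists>\<beta>\<in>elts omega2. \<forall>i\<in>elts omega1. \<sigma> i q \<in> elts \<beta>" for q
    by (rule omega2_bounded[of "elts (omega1 :: 'v)" "\<lambda>i. \<sigma> i q"]) (use \<sigma>(1) in auto)
  then obtain A where A: "\<And>q. A q \<in> elts omega2" "\<And>q i. i \<in> elts omega1 \<Longrightarrow> \<sigma> i q \<in> elts (A q)"
    by metis
  \<comment> \<open>The run in which every move exceeds the bounds named by all
    \<open>omega1\<close> strategies at once.\<close>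
  define P where "P = rec_nat [] (\<lambda>_ q. A q # q)"
  have P: "P n = play (\<lambda>n. A (P n)) [] n" for n by (induction n) (auto simp: P_def)
  have "range (\<lambda>n. A (P n)) \<subseteq> elts omega2" using A(1) by blast
  then obtain i where i: "i \<in> elts omega1" "\<And>n. ok i (P n)"
    using assms[of "\<lambda>n. A (P n)"] unfolding P[symmetric] by blast
  have "\<exists>n. \<not> ok i (play (\<lambda>n. A (P n)) [] n)"
    by (rule \<sigma>(2)[OF i(1)]) (use A i in \<open>auto simp: P[symmetric]\<close>)
  then show False using i(2) unfolding P[symmetric] by blast
qed

text \<open>For some countable ordinal \<open>i\<close>, the game that keeps the traces of closures
  on \<open>omega1\<close> inside \<open>i\<close> is not lost. Each position that is not lost then
  has two incompatible continuations. They span a binary tree whose branches have distinct closures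
  in \<open>C\<close>, all inside the closure \<open>b\<close> of the whole tree.\<close>

lemma club_many_subsets:
  fixes C :: "'v::set_universe set set"
  assumes C: "club (elts omega2) C"
  obtains b where "b \<in> ctbl_subsets (elts omega2)" "(UNIV :: (nat \<Rightarrow> bool) set) \<lesssim> {a \<in> C. a \<subseteq> b}"
proof -
  obtain G0 where G0: "\<And>xs. G0 xs \<in> ctbl_subsets (elts omega2)"
    "\<And>a. a \<in> ctbl_subsets (elts omega2) \<Longrightarrow> closed_under G0 a \<Longrightarrow> a \<in> C"
    by (rule club_contains_closed_sets[OF C]) blast
  \<comment> \<open>The second part makes the trace of a closed set on \<open>omega1\<close> an
    ordinal. The third part makes incompatibility of two members visible in that trace.\<close>
  define G where "G xs = G0 xs \<union> (\<Union>\<alpha>\<in>set xs \<inter> elts omega1. elts \<alpha>) \<union>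
    (\<Union>\<alpha>\<in>set xs \<inter> elts omega2. iota \<alpha> ` (set xs \<inter> elts \<alpha>))" for xs
  have Gc: "countable (G xs)" for xs
    using G0(1)[of xs] omega1(3) unfolding G_def ctbl_subsets_def
    by (auto intro: countable_finite)
  have G2: "closed_under G (elts omega2)"
    unfolding closed_under_def
  proof
    fix xs assume "xs \<in> lists (elts (omega2 :: 'v))"
    have "G0 xs \<subseteq> elts omega2" using G0(1)[of xs] by (simp add: ctbl_subsets_def)
    moreover have "iota \<alpha> \<beta> \<in> elts omega2" if "\<alpha> \<in> elts omega2" "\<beta> \<in> elts \<alpha>" for \<alpha> \<beta> :: 'v
      using iota(2)[OF that] omega1_subset_omega2 by blast
    moreover have "elts \<alpha> \<subseteq> elts omega2" if "\<alpha> \<in> elts omega1" for \<alpha> :: 'v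
      using that Ord_mem_trans[OF omega1(1)] omega1_subset_omega2 by blast
    ultimately show "G xs \<subseteq> elts omega2" unfolding G_def by blast
  qed
  define ok where "ok i p \<longleftrightarrow> set p \<subseteq> elts omega2 \<and> cl G (set p \<union> elts i) \<inter> elts omega1 \<subseteq> elts i" for i p
  have cl2: "cl G s \<subseteq> elts omega2" if "s \<subseteq> elts omega2" for s
    by (rule cl_subset[OF that G2])
  obtain i :: 'v where i: "i \<in> elts omega1" "\<not> lost (ok i) []"
  proof (rule ex_not_lost[of ok])
    fix \<alpha> :: "nat \<Rightarrow> 'v" assume \<alpha>: "range \<alpha> \<subseteq> elts omega2"
    \<comment> \<open>The trace of the closure of a whole run is a countable ordinal, which serves
      as \<open>i\<close> at all of its positions.\<close>
    define a where "a = cl G (range \<alpha>)"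
    have "countable a" unfolding a_def by (rule countable_cl[OF Gc]) simp
    have "transitive (a \<inter> elts omega1)"
      unfolding transitive_def
    proof
      fix \<beta> assume \<beta>: "\<beta> \<in> a \<inter> elts omega1"
      have "G [\<beta>] \<subseteq> a" using closed_under_cl[of G "range \<alpha>"] \<beta> by (auto simp: closed_under_def a_def)
      then have "elts \<beta> \<subseteq> a" using \<beta> unfolding G_def by simp
      then show "elts \<beta> \<subseteq> a \<inter> elts omega1" using \<beta> Ord_mem_trans[OF omega1(1)] by blast
    qed
    then obtain i where i: "Ord i" "elts i = a \<inter> elts omega1"
      by (rule transitive_subset_Ord[OF omega1(1) Int_lower2])
    have "i \<in> elts omega1" by (rule mem_omega1[OF i(1)]) (simp add: i(2) \<open>countable a\<close>)
    moreover have "ok i (play \<alpha> [] n)" for n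
    proof -
      have "cl G (set (play \<alpha> [] n) \<union> elts i) \<subseteq> a"
        by (rule cl_subset) (auto simp: i(2) a_def set_play closed_under_cl intro: cl.base)
      then show ?thesis unfolding ok_def using i(2) \<alpha> by (auto simp: set_play)
    qed
    ultimately show "\<exists>i\<in>elts omega1. \<forall>n. ok i (play \<alpha> [] n)" by blast
  qed blast
  have i2: "elts i \<subseteq> elts omega2" using i(1) Ord_mem_trans[OF omega1(1)] omega1_subset_omega2 by blast
  \<comment> \<open>A closed set whose trace on \<open>\<omega>\<^sub>1\<close> lies in \<open>i\<close> cannot contain both of these answers \<open>\<alpha>\<close> and \<open>\<beta>\<close>.\<close>
  have "\<exists>\<alpha> \<beta>. \<not> lost (ok i) (\<alpha> # p) \<and> \<not> lost (ok i) (\<beta> # p) \<and> \<alpha> \<in> elts omega2 \<and>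
      \<beta> \<in> elts \<alpha> \<and> iota \<alpha> \<beta> \<notin> elts i" if p: "\<not> lost (ok i) p" for p
  proof -
    define E where "E = {\<alpha> \<in> elts omega2. \<not> lost (ok i) (\<alpha> # p)}"
    have E: "\<exists>\<alpha>\<in>E. \<gamma> \<in> elts \<alpha>" if "\<gamma> \<in> elts omega2" for \<gamma>
      using not_lost_step[OF p that] unfolding E_def by blast
    have "uncountable E"
    proof
      assume "countable E"
      then have le: "E \<lesssim> elts (omega1 :: 'v)"
        using lepoll_or_lesspoll[of "elts (omega1 :: 'v)" E] omega1(2) countable_lepoll lesspoll_imp_lepoll
        by blast
      obtain \<beta> where \<beta>: "\<beta> \<in> elts omega2" "\<And>\<alpha>. \<alpha> \<in> E \<Longrightarrow> \<alpha> \<in> elts \<beta>"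
        by (rule omega2_bounded[OF le, of "\<lambda>\<alpha>. \<alpha>"]) (auto simp: E_def)
      then obtain \<alpha> where "\<alpha> \<in> E" "\<beta> \<in> elts \<alpha>" using E by blast
      then show False
        using \<beta> Ord_mem_trans[OF Ord_member[OF omega2(1) \<beta>(1)]] mem_irrefl by blast
    qed
    then obtain f where f: "inj_on f (elts (omega1 :: 'v))" "f ` elts (omega1 :: 'v) \<subseteq> E"
      using omega1_lepoll_uncountable[of E] unfolding lepoll_def by blast
    \<comment> \<open>The \<open>omega1\<close> many answers in \<open>E'\<close> have a common
      bound, and some further answer \<open>\<alpha>\<close> lies above it. The injection
      \<open>iota \<alpha>\<close> cannot send uncountably many of them into the countable
      \<open>i\<close>.\<close>
    define E' where "E' = f ` elts (omega1 :: 'v)"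
    have E': "uncountable E'"
      unfolding E'_def using f(1) omega1(2) countable_image_inj_on by blast
    obtain \<beta> where \<beta>: "\<beta> \<in> elts omega2" "\<And>\<alpha>. \<alpha> \<in> E' \<Longrightarrow> \<alpha> \<in> elts \<beta>"
      by (rule omega2_bounded[of E' "\<lambda>\<alpha>. \<alpha>"])
        (use f(2) in \<open>auto simp: E'_def E_def intro: image_lepoll\<close>)
    obtain \<alpha> where \<alpha>: "\<alpha> \<in> E" "\<beta> \<in> elts \<alpha>" using E[OF \<beta>(1)] by blast
    have \<alpha>2: "\<alpha> \<in> elts omega2" using \<alpha>(1) by (simp add: E_def)
    have sub: "E' \<subseteq> elts \<alpha>"
      using \<beta>(2) \<alpha>(2) Ord_mem_trans[OF Ord_member[OF omega2(1) \<alpha>2]] by blast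
    have "\<not> iota \<alpha> ` E' \<subseteq> elts i"
    proof
      assume "iota \<alpha> ` E' \<subseteq> elts i"
      then have "countable (iota \<alpha> ` E')" using omega1(3)[OF i(1)] countable_subset by blast
      then show False
        using E' countable_image_inj_on inj_on_subset[OF iota(1)[OF \<alpha>2] sub] by blast
    qed
    then show ?thesis using sub f(2) \<alpha>(1) \<alpha>2 unfolding E'_def E_def by blast
  qed
  then obtain u v where uv: "\<And>p. \<not> lost (ok i) p \<Longrightarrow> \<not> lost (ok i) (u p # p) \<and>
      \<not> lost (ok i) (v p # p) \<and> u p \<in> elts omega2 \<and> v p \<in> elts (u p) \<and> iota (u p) (v p) \<notin> elts i"
    by metis
  \<comment> \<open>The tree of positions, indexed by finite bit lists with the latest bit at the
    head.\<close>
  define P where "P = rec_list [] (\<lambda>x _ p. (if x then u p else v p) # p)"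
  have PN: "P [] = []" and PC: "P (x # xs) = (if x then u (P xs) else v (P xs)) # P xs" for x xs
    by (simp_all add: P_def)
  have Pl: "\<not> lost (ok i) (P xs)" for xs
    by (induction xs) (use i(2) uv in \<open>simp_all add: PN PC\<close>)
  have Pok: "ok i (P xs)" for xs using Pl not_lost_ok by blast
  define b where "b = cl G ((\<Union>xs. set (P xs)) \<union> elts i)"
  define a where "a x = cl G ((\<Union>n. set (P (map x (rev [0..<n])))) \<union> elts i)" for x
  have "countable (\<Union>xs. set (P xs))"
    by (rule countable_UN) (simp_all add: countable_finite)
  then have b: "b \<in> ctbl_subsets (elts omega2)"
    using Pok i2 cl2[of "(\<Union>xs. set (P xs)) \<union> elts i"] omega1(3)[OF i(1)]
    unfolding ctbl_subsets_def b_def ok_def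
    by (auto intro!: countable_cl Gc intro: countable_finite)
  have ab: "a x \<subseteq> b" for x unfolding a_def b_def by (rule cl_mono) blast
  have aC: "a x \<in> C" for x
  proof (rule G0(2))
    show "a x \<in> ctbl_subsets (elts omega2)"
      using b ab[of x] countable_subset unfolding ctbl_subsets_def by blast
    show "closed_under G0 (a x)"
      using closed_under_cl[of G] unfolding a_def closed_under_def G_def by blast
  qed
  \<comment> \<open>An element of the closure of a branch is generated by finitely many elements,
    hence by one position together with \<open>i\<close>, where \<open>ok\<close> applies.\<close>
  have a1: "a x \<inter> elts omega1 \<subseteq> elts i" for x
  proof
    fix z assume z: "z \<in> a x \<inter> elts omega1"
    let ?X = "\<lambda>n. map x (rev [0..<n])"
    have mono: "set (P (?X m)) \<subseteq> set (P (?X n))" if "m \<le> n" for m n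
      using that by (induction n rule: dec_induct) (auto simp: PC)
    from z have "z \<in> cl G ((\<Union>n. set (P (?X n))) \<union> elts i)" unfolding a_def by simp
    then obtain zs where zs: "zs \<in> lists ((\<Union>n. set (P (?X n))) \<union> elts i)" "z \<in> cl G (set zs)"
      by (rule cl_finitary)
    from zs(1) have "\<exists>n. set zs \<subseteq> set (P (?X n)) \<union> elts i"
    proof (induction zs)
      case (Cons y zs)
      then obtain m n where mn: "y \<in> set (P (?X m)) \<union> elts i" "set zs \<subseteq> set (P (?X n)) \<union> elts i"
        by auto
      then show ?case
        using mono[of m "max m n"] mono[of n "max m n"] by (intro exI[of _ "max m n"]) auto
    qed simp
    then obtain n where "set zs \<subseteq> set (P (?X n)) \<union> elts i" by blast
    then have "z \<in> cl G (set (P (?X n)) \<union> elts i)" using zs(2) cl_mono[of "set zs"] by blast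
    then show "z \<in> elts i" using Pok[of "?X n"] z unfolding ok_def by blast
  qed
  have nuv: False if "u p \<in> a x" "v p \<in> a x" "\<not> lost (ok i) p" for p x
  proof -
    have "iota (u p) (v p) \<in> G [u p, v p]" using uv[OF that(3)] by (simp add: G_def)
    moreover have "G [u p, v p] \<subseteq> a x"
      using closed_under_cl[of G] that unfolding a_def closed_under_def
      by (auto dest: bspec[of _ _ "[u p, v p]"])
    moreover have "iota (u p) (v p) \<in> elts omega1" using uv[OF that(3)] iota(2) by blast
    ultimately show False using a1 uv[OF that(3)] by blast
  qed
  have "inj a"
  proof (rule injI, rule ccontr)
    fix x y :: "nat \<Rightarrow> bool" assume xy: "a x = a y" "x \<noteq> y"
    then have "\<exists>n. x n \<noteq> y n" by auto
    \<comment> \<open>Up to the first difference both branches share the position \<open>?p\<close>;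
      then one chooses \<open>u ?p\<close> and the other \<open>v ?p\<close>. Equal closures would
      contain both.\<close>
    define n where "n = (LEAST n. x n \<noteq> y n)"
    have n: "x n \<noteq> y n" unfolding n_def using \<open>\<exists>n. x n \<noteq> y n\<close> by (rule LeastI_ex)
    have "x m = y m" if "m < n" for m using not_less_Least that unfolding n_def by blast
    then have eq: "map x (rev [0..<n]) = map y (rev [0..<n])" by simp
    let ?p = "P (map x (rev [0..<n]))"
    have mem: "(if z n then u (P (map z (rev [0..<n]))) else v (P (map z (rev [0..<n])))) \<in> a z" for z
    proof -
      have "hd (P (map z (rev [0..<Suc n]))) \<in> set (P (map z (rev [0..<Suc n])))"
        by (simp add: PC)
      then have "hd (P (map z (rev [0..<Suc n]))) \<in> a z" unfolding a_def by (blast intro: cl.base)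
      then show ?thesis by (simp add: PC)
    qed
    have "u ?p \<in> a x" "v ?p \<in> a x"
      using mem[of x] mem[of y] n unfolding xy(1) eq by (auto split: if_splits)
    then show False using nuv Pl by blast
  qed
  then have "(UNIV :: (nat \<Rightarrow> bool) set) \<lesssim> {a \<in> C. a \<subseteq> b}"
    unfolding lepoll_def using aC ab by blast
  with b show thesis by (rule that)
qed

section \<open>The size of the continuum under reflection\<close>

lemma countable_subset_omega1_bounded:
  fixes A :: "'v::set_universe set"
  assumes "countable A" "A \<subseteq> elts omega1"
  obtains i where "i \<in> elts omega1" "A \<subseteq> elts i"
proof -
  let ?B = "\<Union>\<alpha>\<in>A. insert \<alpha> (elts \<alpha>)"
  have sub: "?B \<subseteq> elts omega1" using assms(2) Ord_mem_trans[OF omega1(1)] by blast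
  have "transitive ?B"
    unfolding transitive_def using assms(2) Ord_member[OF omega1(1)] Ord_mem_trans by blast
  then obtain i where i: "Ord i" "elts i = ?B" by (rule transitive_subset_Ord[OF omega1(1) sub])
  have "countable ?B" using assms omega1(3) by (intro countable_UN) auto
  then have "i \<in> elts omega1" using i by (intro mem_omega1) auto
  then show thesis using i(2) by (intro that) auto
qed

text \<open>For \<open>\<eta>\<close> below \<open>omega2\<close> this is a continuous filtration of
  \<open>\<eta>\<close> into countable sets, a club with at most \<open>omega1\<close>
  members.\<close>

definition initial_segments :: "'v::set_universe \<Rightarrow> 'v set set" where
  "initial_segments \<eta> = (\<lambda>i. {\<beta> \<in> elts \<eta>. iota \<eta> \<beta> \<in> elts i}) ` elts omega1"

lemma club_initial_segments:
  fixes \<eta> :: "'v::set_universe"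
  assumes \<eta>: "\<eta> \<in> elts omega2"
  shows "club (elts \<eta>) (initial_segments \<eta>)"
  unfolding club_def
proof (intro conjI ballI allI impI)
  show "initial_segments \<eta> \<subseteq> ctbl_subsets (elts \<eta>)"
  proof
    fix a assume "a \<in> initial_segments \<eta>"
    then obtain i where i: "i \<in> elts omega1" "a = {\<beta> \<in> elts \<eta>. iota \<eta> \<beta> \<in> elts i}"
      unfolding initial_segments_def by blast
    have "iota \<eta> ` a \<subseteq> elts i" using i(2) by blast
    then have "countable (iota \<eta> ` a)" using omega1(3)[OF i(1)] by (rule countable_subset)
    moreover have "inj_on (iota \<eta>) a" using i(2) by (intro inj_on_subset[OF iota(1)[OF \<eta>]]) blast
    ultimately have "countable a" by (rule countable_image_inj_on)
    then show "a \<in> ctbl_subsets (elts \<eta>)" using i(2) by (auto simp: ctbl_subsets_def)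
  qed
  fix a assume a: "a \<in> ctbl_subsets (elts \<eta>)"
  then have "countable (iota \<eta> ` a)" "iota \<eta> ` a \<subseteq> elts omega1"
    using iota(2)[OF \<eta>] by (auto simp: ctbl_subsets_def)
  then obtain i where "i \<in> elts omega1" "iota \<eta> ` a \<subseteq> elts i"
    by (rule countable_subset_omega1_bounded)
  then show "\<exists>c\<in>initial_segments \<eta>. a \<subseteq> c"
    using a unfolding initial_segments_def ctbl_subsets_def by blast
next
  fix c :: "nat \<Rightarrow> 'v set" assume "range c \<subseteq> initial_segments \<eta> \<and> mono c"
  then have "\<forall>n. \<exists>i\<in>elts omega1. c n = {\<beta> \<in> elts \<eta>. iota \<eta> \<beta> \<in> elts i}"
    unfolding initial_segments_def by blast
  then obtain i where i: "\<And>n. i n \<in> elts omega1" "\<And>n. c n = {\<beta> \<in> elts \<eta>. iota \<eta> \<beta> \<in> elts (i n)}"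
    by metis
  have sub: "(\<Union>n. elts (i n)) \<subseteq> elts omega1" using i(1) Ord_mem_trans[OF omega1(1)] by blast
  have "transitive (\<Union>n. elts (i n))"
    unfolding transitive_def using i(1) Ord_member[OF omega1(1)] Ord_mem_trans by blast
  then obtain j where j: "Ord j" "elts j = (\<Union>n. elts (i n))"
    by (rule transitive_subset_Ord[OF omega1(1) sub])
  have "countable (\<Union>n. elts (i n))" using i(1) omega1(3) by (intro countable_UN) auto
  then have "j \<in> elts omega1" using j by (intro mem_omega1) auto
  moreover have "(\<Union>n. c n) = {\<beta> \<in> elts \<eta>. iota \<eta> \<beta> \<in> elts j}" using i(2) j(2) by auto
  ultimately show "(\<Union>n. c n) \<in> initial_segments \<eta>" unfolding initial_segments_def by blast
qed

text \<open>By reflection the \<open>omega2\<close> many filtrations together contain a club, so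
  that club has at most \<open>omega2\<close> members; but it has at least continuum many.\<close>

lemma RP_continuum:
  assumes "RP (omega2 :: 'v::set_universe)"
  shows "(UNIV :: (nat \<Rightarrow> bool) set) \<lesssim> elts (omega2 :: 'v)"
proof -
  have ex: "\<exists>C. club (elts \<eta>) C \<and> C \<subseteq> initial_segments \<eta>" if "\<eta> \<in> elts omega2" for \<eta> :: 'v
    using club_initial_segments[OF that] by blast
  obtain C where C: "club (elts (omega2 :: 'v)) C"
    "C \<subseteq> (\<Union>\<eta>\<in>elts omega2. initial_segments \<eta>)"
    by (rule RP_union_contains_club[where D = initial_segments, OF assms ex])
  have le: "initial_segments \<eta> \<lesssim> elts (omega2 :: 'v)" for \<eta> :: 'v
    unfolding initial_segments_def
    by (rule lepoll_trans[OF image_lepoll subset_imp_lepoll[OF omega1_subset_omega2]])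
  obtain b where 1: "(UNIV :: (nat \<Rightarrow> bool) set) \<lesssim> {a \<in> C. a \<subseteq> b}"
    by (rule club_many_subsets[OF C(1)])
  have 2: "(\<Union>\<eta>\<in>elts (omega2 :: 'v). initial_segments \<eta>) \<lesssim> elts (omega2 :: 'v)"
    by (rule UN_lepoll[OF infinite_omega2 lepoll_refl le])
  have 3: "{a \<in> C. a \<subseteq> b} \<lesssim> (\<Union>\<eta>\<in>elts (omega2 :: 'v). initial_segments \<eta>)"
    using C(2) by (intro subset_imp_lepoll) blast
  show ?thesis by (rule lepoll_trans[OF 1 lepoll_trans[OF 3 2]])
qed

text \<open>Every countable subset of \<open>omega1\<close> is bounded, and each countable ordinal
  has at most continuum many subsets. \<open>B\<close> is general because the bound is needed for
  \<open>omega2\<close> and, in deriving CH, for \<open>omega1\<close>.\<close>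

lemma ctbl_subsets_omega1_lepoll:
  assumes "(UNIV :: (nat \<Rightarrow> bool) set) \<lesssim> B" "elts (omega1 :: 'v::set_universe) \<lesssim> B"
  shows "ctbl_subsets (elts (omega1 :: 'v)) \<lesssim> B"
proof -
  have "ctbl_subsets (elts (omega1 :: 'v)) \<subseteq> (\<Union>i\<in>elts omega1. Pow (elts i))"

  proof
    fix a assume "a \<in> ctbl_subsets (elts (omega1 :: 'v))"
    then have "countable a" "a \<subseteq> elts omega1" by (auto simp: ctbl_subsets_def)
    then obtain i where "i \<in> elts omega1" "a \<subseteq> elts i" by (rule countable_subset_omega1_bounded)
    then show "a \<in> (\<Union>i\<in>elts omega1. Pow (elts i))" by blast
  qed
  moreover have "Pow (elts i) \<lesssim> B" if i: "i \<in> elts omega1" for i :: 'v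
  proof -
    obtain f :: "'v \<Rightarrow> nat" where f: "inj_on f (elts i)" by (rule countableE[OF omega1(3)[OF i]])
    have "inj_on (\<lambda>a n. n \<in> f ` a) (Pow (elts i))"
    proof (rule inj_onI)
      fix a b assume "a \<in> Pow (elts i)" "b \<in> Pow (elts i)" "(\<lambda>n. n \<in> f ` a) = (\<lambda>n. n \<in> f ` b)"
      then have "a \<subseteq> elts i" "b \<subseteq> elts i" "f ` a = f ` b" by (auto dest: fun_cong)
      then show "a = b" using inj_on_image_eq_iff[OF f] by blast
    qed
    then have "Pow (elts i) \<lesssim> (UNIV :: (nat \<Rightarrow> bool) set)" unfolding lepoll_def by blast
    then show ?thesis using assms(1) by (rule lepoll_trans)
  qed
  moreover have "infinite B"
    using assms(2) infinite_omega1 unfolding lepoll_def by (meson finite_imageD finite_subset)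
  ultimately show ?thesis
    using UN_lepoll[OF _ assms(2), of "\<lambda>i. Pow (elts i)"] lepoll_trans subset_imp_lepoll by metis
qed

section \<open>Ideals\<close>

lemma Hset_subset:
  fixes x :: "'v::set_universe"
  assumes "x \<in> Hset \<theta>" "elts y \<subseteq> elts x"
  shows "y \<in> Hset \<theta>"
proof -
  have "trcl y \<subseteq> trcl x"
  proof
    fix z assume "z \<in> trcl y"
    then have "(\<lambda>u v. u \<in> elts v)\<^sup>+\<^sup>+ z y" by (simp add: trcl_def)
    then have "(\<lambda>u v. u \<in> elts v)\<^sup>+\<^sup>+ z x"
    proof cases
      case r_into_trancl
      then show ?thesis using assms(2) by (intro tranclp.r_into_trancl) blast
    next
      case (trancl_into_trancl w)
      have "w \<in> elts x" using trancl_into_trancl(2) assms(2) by blast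
      with trancl_into_trancl(1) show ?thesis by (rule tranclp.trancl_into_trancl)
    qed
    then show "z \<in> trcl x" by (simp add: trcl_def)
  qed
  then show ?thesis
    using assms(1) lesspoll_trans1 subset_imp_lepoll unfolding Hset_def by blast
qed

lemma trcl_Ord:
  fixes \<alpha> :: "'v::set_universe"
  assumes "Ord \<alpha>"
  shows "trcl \<alpha> \<subseteq> elts \<alpha>"
proof
  fix z assume "z \<in> trcl \<alpha>"
  then have "(\<lambda>u v. u \<in> elts v)\<^sup>+\<^sup>+ z \<alpha>" by (simp add: trcl_def)
  then show "z \<in> elts \<alpha>"
    by (induction rule: converse_tranclp_induct) (auto intro: Ord_mem_trans[OF assms])
qed

lemma omega2_subset_Hset:
  assumes "elts omega2 \<subseteq> elts (\<theta> :: 'v::set_universe)"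
  shows "elts omega2 \<subseteq> Hset \<theta>"
proof
  fix \<alpha> :: 'v assume \<alpha>: "\<alpha> \<in> elts omega2"
  have "trcl \<alpha> \<lesssim> elts (omega1 :: 'v)"
    using subset_imp_lepoll[OF trcl_Ord[OF Ord_member[OF omega2(1) \<alpha>]]] omega2(3)[OF \<alpha>]
    by (rule lepoll_trans)
  then have "trcl \<alpha> \<prec> elts (omega2 :: 'v)" using omega2(2) by (rule lesspoll_trans1)
  then have "trcl \<alpha> \<prec> elts \<theta>" using subset_imp_lepoll[OF assms] by (rule lesspoll_trans2)
  then show "\<alpha> \<in> Hset \<theta>" by (simp add: Hset_def)
qed

section \<open>Properties of almost every M modulo an ideal\<close>

definition almost_all :: "'v::set_universe \<Rightarrow> 'v set set set \<Rightarrow> ('v set \<Rightarrow> bool) \<Rightarrow> bool" where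
  "almost_all \<theta> I P \<longleftrightarrow> {M \<in> Zset \<theta>. \<not> P M} \<in> I"

lemma ideal_subset:
  assumes "ideal \<theta> I" "A \<in> I" "B \<subseteq> A"
  shows "B \<in> I"
proof -
  have "\<forall>A B. A \<in> I \<and> B \<subseteq> A \<longrightarrow> B \<in> I" using assms(1) unfolding ideal_def by (elim conjE)
  then show ?thesis using assms(2,3) by blast
qed

lemma ideal_countable_Union:
  assumes "ideal \<theta> I" "\<A> \<subseteq> I" "countable \<A>"
  shows "\<Union>\<A> \<in> I"
proof -
  have "\<forall>\<A>. \<A> \<subseteq> I \<and> countable \<A> \<longrightarrow> \<Union>\<A> \<in> I"
    using assms(1) unfolding ideal_def by (elim conjE)
  then show ?thesis using assms(2,3) by simp
qed

lemma almost_all_mono: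
  "ideal \<theta> I \<Longrightarrow> almost_all \<theta> I P \<Longrightarrow> (\<And>M. M \<in> Zset \<theta> \<Longrightarrow> P M \<Longrightarrow> Q M) \<Longrightarrow> almost_all \<theta> I Q"
  unfolding almost_all_def by (erule ideal_subset) auto

lemma almost_all_conj:
  assumes "ideal \<theta> I" "almost_all \<theta> I P" "almost_all \<theta> I Q"
  shows "almost_all \<theta> I (\<lambda>M. P M \<and> Q M)"
proof -
  have "\<Union>{{M \<in> Zset \<theta>. \<not> P M}, {M \<in> Zset \<theta>. \<not> Q M}} \<in> I"
    using assms(2,3) unfolding almost_all_def by (intro ideal_countable_Union[OF assms(1)]) auto
  then show ?thesis
    unfolding almost_all_def by (rule ideal_subset[OF assms(1)]) blast
qed

lemma almost_all_ex:
  assumes "ideal \<theta> I" "almost_all \<theta> I P"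
  obtains M where "M \<in> Zset \<theta>" "P M"
proof -
  have "Zset \<theta> \<notin> I" using assms(1) by (simp add: ideal_def)
  then have "{M \<in> Zset \<theta>. \<not> P M} \<noteq> Zset \<theta>" using assms(2) unfolding almost_all_def by auto
  then show thesis using that by blast
qed

lemma almost_all_fine: "ideal \<theta> I \<Longrightarrow> b \<in> Hset \<theta> \<Longrightarrow> almost_all \<theta> I (\<lambda>M. b \<in> M)"
  by (simp add: ideal_def fine_def almost_all_def)

lemma ideal_normal:
  assumes "ideal \<theta> I" "S \<subseteq> Zset \<theta>" "S \<notin> I" "\<And>M. M \<in> S \<Longrightarrow> g M \<in> M"
  obtains T b where "T \<subseteq> S" "T \<notin> I" "\<And>M. M \<in> T \<Longrightarrow> g M = b"
proof -
  have "normal \<theta> I" using assms(1) by (simp add: ideal_def)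
  then have "\<exists>S' b. S' \<subseteq> S \<and> S' \<notin> I \<and> (\<forall>M\<in>S'. g M = b)"
    using assms(2-4) unfolding normal_def by simp
  then show thesis using that by blast
qed

text \<open>Closure of the dual filter under diagonal intersections: choosing a counterexample in
  each bad \<open>M\<close> is regressive, so by normality it is constant on a positive set.\<close>

lemma almost_all_ball:
  assumes I: "ideal \<theta> I" and P: "\<And>x. x \<in> Hset \<theta> \<Longrightarrow> almost_all \<theta> I (P x)"
  shows "almost_all \<theta> I (\<lambda>M. \<forall>x\<in>M. P x M)"
proof (rule ccontr)
  let ?S = "{M \<in> Zset \<theta>. \<not> (\<forall>x\<in>M. P x M)}"
  define g where "g M = (SOME x. x \<in> M \<and> \<not> P x M)" for M
  assume "\<not> almost_all \<theta> I (\<lambda>M. \<forall>x\<in>M. P x M)"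
  then have n: "?S \<notin> I" by (simp add: almost_all_def)
  have g: "g M \<in> M \<and> \<not> P (g M) M" if "M \<in> ?S" for M
    unfolding g_def by (rule someI_ex) (use that in blast)
  obtain T b where T: "T \<subseteq> ?S" "T \<notin> I" "\<And>M. M \<in> T \<Longrightarrow> g M = b"
    by (rule ideal_normal[OF I _ n, of g]) (use g in auto)
  have "T \<noteq> {}" using T(2) I by (auto simp: ideal_def)
  then obtain M where "M \<in> T" by blast
  then have "b \<in> M" "M \<subseteq> Hset \<theta>" using g[of M] T by (auto simp: Zset_def)
  then have "{M \<in> Zset \<theta>. \<not> P b M} \<in> I" using P[of b] by (auto simp: almost_all_def)
  moreover have "T \<subseteq> {M \<in> Zset \<theta>. \<not> P b M}" using T g by fastforce
  ultimately show False using T(2) ideal_subset[OF I] by blast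
qed

text \<open>Two diagonal intersections reduce the claim to fineness. This supplies all closure
  properties of models that are used in place of elementarity.\<close>

lemma almost_all_closed:
  assumes I: "ideal \<theta> I" and F: "\<And>x y. x \<in> Hset \<theta> \<Longrightarrow> y \<in> Hset \<theta> \<Longrightarrow> F x y \<in> Hset \<theta>"
  shows "almost_all \<theta> I (\<lambda>M. \<forall>x\<in>M. \<forall>y\<in>M. F x y \<in> M)"
  by (rule almost_all_ball[OF I], rule almost_all_ball[OF I], rule almost_all_fine[OF I F])

lemma almost_all_dual:
  assumes "A \<in> dual_filter \<theta> I" "ideal \<theta> I"
  shows "almost_all \<theta> I (\<lambda>M. M \<in> A)"
proof -
  obtain B where B: "A = Zset \<theta> - B" "B \<in> I" using assms(1) unfolding dual_filter_def by blast
  show ?thesis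
    unfolding almost_all_def B(1) by (rule ideal_subset[OF assms(2) B(2)]) blast
qed

lemma almost_all_concentrates:
  assumes "ideal \<theta> I" "concentrates_on \<theta> I \<Gamma>"
  shows "almost_all \<theta> I (\<lambda>M. M \<in> \<Gamma>)"
proof -
  obtain A where A: "A \<subseteq> \<Gamma>" "A \<in> dual_filter \<theta> I" using assms(2) unfolding concentrates_on_def by blast
  show ?thesis
    by (rule almost_all_mono[OF assms(1) almost_all_dual[OF A(2) assms(1)]]) (use A(1) in blast)
qed

text \<open>Normality gives closure under unions of \<open>omega1\<close> members, since an index
  below \<open>omega1\<close> is a regressive choice when \<open>omega1\<close> is included in
  \<open>M\<close>. With larger completeness than \<open>omega2\<close>, fineness would put all of
  \<open>omega2\<close> into almost every \<open>M\<close>, against its size.\<close>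

lemma completeness_eq_omega2:
  fixes I :: "'v::set_universe set set set"
  assumes I: "ideal \<theta> I" and \<mu>: "completeness I \<mu>"
    and w1: "almost_all \<theta> I (\<lambda>M. elts omega1 \<subseteq> M)"
    and small: "almost_all \<theta> I (\<lambda>M. M \<lesssim> elts (omega1 :: 'v))"
  shows "\<mu> = omega2"
proof -
  have OC: "Ord \<mu>" "\<And>\<alpha>. \<alpha> \<in> elts \<mu> \<Longrightarrow> elts \<alpha> \<prec> elts \<mu>"
    and less: "\<And>\<A>. \<A> \<subseteq> I \<Longrightarrow> \<A> \<prec> elts \<mu> \<Longrightarrow> \<Union>\<A> \<in> I"
    using \<mu> unfolding completeness_def Card_def by blast+
  obtain \<A> where \<A>: "\<A> \<subseteq> I" "\<A> \<approx> elts \<mu>" "\<Union>\<A> \<notin> I" using \<mu> unfolding completeness_def by blast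
  have le: "\<A> \<lesssim> elts \<mu>" using \<A>(2) by (rule eqpoll_imp_lepoll)
  have "\<not> elts \<mu> \<lesssim> elts (omega1 :: 'v)"
  proof
    assume "elts \<mu> \<lesssim> elts (omega1 :: 'v)"
    then have "\<A> \<lesssim> elts (omega1 :: 'v)" by (rule lepoll_trans[OF le])
    then obtain k :: "'v set set \<Rightarrow> 'v" where k: "inj_on k \<A>" "k ` \<A> \<subseteq> elts omega1"
      unfolding lepoll_def by blast
    define S where "S = {M \<in> \<Union>\<A>. M \<in> Zset \<theta> \<and> elts omega1 \<subseteq> M}"
    define g where "g M = k (SOME A. A \<in> \<A> \<and> M \<in> A)" for M
    have g: "(SOME A. A \<in> \<A> \<and> M \<in> A) \<in> \<A> \<and> M \<in> (SOME A. A \<in> \<A> \<and> M \<in> A)" if "M \<in> S" for M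
      by (rule someI_ex) (use that in \<open>auto simp: S_def\<close>)
    have "\<Union>{S, {M \<in> Zset \<theta>. \<not> elts omega1 \<subseteq> M}} \<in> I" if "S \<in> I"
      using that w1 unfolding almost_all_def by (intro ideal_countable_Union[OF I]) auto
    moreover have "I \<subseteq> Pow (Zset \<theta>)" using I by (simp add: ideal_def)
    then have "\<Union>\<A> \<subseteq> Zset \<theta>" using \<A>(1) by blast
    then have "\<Union>\<A> \<subseteq> \<Union>{S, {M \<in> Zset \<theta>. \<not> elts omega1 \<subseteq> M}}" unfolding S_def by auto
    ultimately have "S \<notin> I" using \<A>(3) ideal_subset[OF I] by blast
    moreover have "S \<subseteq> Zset \<theta>" unfolding S_def by blast
    moreover have "g M \<in> M" if "M \<in> S" for M
      using g[OF that] k(2) that unfolding g_def S_def by blast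
    ultimately obtain T b where T: "T \<subseteq> S" "T \<notin> I" "\<And>M. M \<in> T \<Longrightarrow> g M = b"
      using ideal_normal[OF I, of S g] by metis
    have "T \<noteq> {}" using T(2) I by (auto simp: ideal_def)
    then obtain M where M: "M \<in> T" by blast
    let ?A = "SOME A. A \<in> \<A> \<and> M \<in> A"
    have "T \<subseteq> ?A"
    proof
      fix N assume N: "N \<in> T"
      have "k (SOME A. A \<in> \<A> \<and> N \<in> A) = k ?A" using T(3)[OF M] T(3)[OF N] unfolding g_def by simp
      then have "(SOME A. A \<in> \<A> \<and> N \<in> A) = ?A"
        using k(1) g M N T(1) by (meson inj_onD subsetD)
      then show "N \<in> ?A" using g[of N] N T(1) by auto
    qed
    moreover have "?A \<in> I" using g[of M] M T(1) \<A>(1) by blast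
    ultimately show False using T(2) ideal_subset[OF I] by blast
  qed
  then have "\<mu> \<notin> elts omega2" using omega2(3) by blast
  moreover have "omega2 \<notin> elts \<mu>"
  proof
    assume mem: "omega2 \<in> elts \<mu>"
    let ?\<A> = "(\<lambda>b. {M \<in> Zset \<theta>. b \<notin> M}) ` elts (omega2 :: 'v)"
    have "elts (omega2 :: 'v) \<subseteq> Hset \<theta>" using I by (intro omega2_subset_Hset) (simp add: ideal_def)
    then have "?\<A> \<subseteq> I" using almost_all_fine[OF I] unfolding almost_all_def by blast
    moreover have "?\<A> \<prec> elts \<mu>" by (rule lesspoll_trans1[OF image_lepoll OC(2)[OF mem]])
    ultimately have "\<Union>?\<A> \<in> I" by (rule less)
    then have "almost_all \<theta> I (\<lambda>M. elts omega2 \<subseteq> M)"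
      unfolding almost_all_def by (rule ideal_subset[OF I]) blast
    then obtain M :: "'v set" where M: "elts omega2 \<subseteq> M" "M \<lesssim> elts (omega1 :: 'v)"
      by (rule almost_all_ex[OF I almost_all_conj[OF I _ small]]) blast
    have "elts (omega2 :: 'v) \<lesssim> elts (omega1 :: 'v)"
      by (rule lepoll_trans[OF subset_imp_lepoll[OF M(1)] M(2)])
    then show False using omega2(2) lesspoll_trans1 not_lesspoll_self by blast
  qed
  ultimately show ?thesis using Ord_linear[OF OC(1) omega2(1)] by blast
qed

section \<open>Guessing models refute CH\<close>

lemma collapse_eq_self:
  fixes x :: "'v::set_universe"
  assumes M: "elts omega1 \<subseteq> M" and x: "elts x \<subseteq> elts omega1"
  shows "collapse M x = x"
proof -
  have id: "collapse M i = i" if "i \<in> elts omega1" for i :: 'v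
    using that
  proof (induction i rule: mem_induct)
    case (1 i)
    have "elts i \<subseteq> elts omega1" using Ord_mem_trans[OF omega1(1) 1(2)] by blast
    then have "elts i \<inter> M = elts i" "\<And>j. j \<in> elts i \<Longrightarrow> collapse M j = j" using M 1(1) by auto
    then show ?case by (intro extensionality) (simp add: elts_collapse)
  qed
  have "elts x \<inter> M = elts x" using M x by blast
  moreover have "collapse M ` elts x = elts x" using id x by force
  ultimately show ?thesis by (intro extensionality) (simp add: elts_collapse)
qed

text \<open>All countable pieces of a subset of \<open>omega1\<close> are in the collapse
  \<open>N\<close>, so approximation puts every subset of \<open>omega1\<close> into
  \<open>N\<close>. By Cantor, \<open>N\<close> is too small for that.\<close>

lemma guessing_not_all_countable:
  fixes M :: "'v::set_universe set"
  assumes M: "M \<in> G_omega1" and w1: "omega1 \<in> M"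
    and all: "\<And>s. s \<in> ctbl_subsets (elts omega1) \<Longrightarrow> the_set s \<in> M"
  shows False
proof -
  define N where "N = transitive_collapse M"
  have sub: "elts omega1 \<subseteq> M" and le: "M \<lesssim> elts (omega1 :: 'v)" and N: "omega1_approximation N"
    using M eqpoll_imp_lepoll unfolding G_omega1_def omega1_guessing_def N_def by blast+
  have inN: "x \<in> N" if "x \<in> M" "elts x \<subseteq> elts omega1" for x
    using that collapse_eq_self[OF sub that(2)] unfolding N_def transitive_collapse_def
    by (metis imageI)
  have "the_set A \<in> N" if A: "A \<subseteq> elts omega1" for A
  proof -
    have e: "elts (the_set A) = A" by (rule elts_the_set_subset[OF A])
    have "the_set (elts z \<inter> A) \<in> N" if "countable_in N z" for z
    proof (rule inN)
      obtain g :: "'v \<Rightarrow> 'v" where g: "inj_on g (elts z)" "g ` elts z \<subseteq> elts omega"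
        using \<open>countable_in N z\<close> by (auto simp: countable_in_def injection_def)
      have "countable (elts z)"
        using countable_subset[OF g(2) countable_omega] g(1) by (rule countable_image_inj_on)
      then have s: "elts z \<inter> A \<in> ctbl_subsets (elts omega1)" using A by (auto simp: ctbl_subsets_def)
      then show "the_set (elts z \<inter> A) \<in> M" by (rule all)
      show "elts (the_set (elts z \<inter> A)) \<subseteq> elts omega1"
        using A elts_the_set_subset[of "elts z \<inter> A" omega1] by blast
    qed
    moreover have "elts (the_set A) \<subseteq> elts omega1" using A e by simp
    moreover have "omega1 \<in> N" by (rule inN[OF w1]) simp
    ultimately show ?thesis using N e unfolding omega1_approximation_def by (elim conjE) metis
  qed
  moreover have "inj_on the_set (Pow (elts (omega1 :: 'v)))"
  proof (rule inj_onI)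
    fix A B :: "'v set"
    assume AB: "A \<in> Pow (elts omega1)" "B \<in> Pow (elts omega1)" "the_set A = the_set B"
    then have "A \<subseteq> elts omega1" "B \<subseteq> elts omega1" by auto
    then show "A = B" using AB(3) elts_the_set_subset by metis
  qed
  ultimately have "Pow (elts (omega1 :: 'v)) \<lesssim> N" unfolding lepoll_def by blast
  also have "N \<lesssim> M" unfolding N_def transitive_collapse_def by (rule image_lepoll)
  also note le
  finally have "Pow (elts (omega1 :: 'v)) \<lesssim> elts (omega1 :: 'v)" .
  then have "elts (omega1 :: 'v) \<prec> elts (omega1 :: 'v)" using lesspoll_Pow_self by (rule lesspoll_trans2[rotated])
  then show False by (simp add: lesspoll_def)
qed

text \<open>Under CH the countable subsets of \<open>omega1\<close> have countable ordinals as
  indices. Almost every \<open>M\<close> contains these indices and is closed under decoding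
  them.\<close>

lemma guessing_ideal_not_CH:
  fixes I :: "'v::set_universe set set set"
  assumes I: "ideal \<theta> I" and G: "almost_all \<theta> I (\<lambda>M. M \<in> G_omega1)"
  shows "\<not> ctbl_subsets (elts (omega1 :: 'v)) \<lesssim> elts (omega1 :: 'v)"
proof
  let ?S = "ctbl_subsets (elts (omega1 :: 'v))"
  assume "?S \<lesssim> elts (omega1 :: 'v)"
  then obtain k where k: "inj_on k ?S" "k ` ?S \<subseteq> elts (omega1 :: 'v)" unfolding lepoll_def by blast
  have "elts omega2 \<subseteq> Hset \<theta>" using I by (intro omega2_subset_Hset) (simp add: ideal_def)
  then have w1: "omega1 \<in> Hset \<theta>" using omega1_mem_omega2 by blast
  \<comment> \<open>The second argument is a dummy that fits the binary form of
    \<open>almost_all_closed\<close>.\<close>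
  define F where "F x y = (if x \<in> k ` ?S then the_set (inv_into ?S k x) else x)" for x y :: 'v
  have "F x y \<in> Hset \<theta>" if "x \<in> Hset \<theta>" "y \<in> Hset \<theta>" for x y
  proof (cases "x \<in> k ` ?S")
    case True
    then have s: "inv_into ?S k x \<subseteq> elts omega1"
      using inv_into_into[OF True] by (auto simp: ctbl_subsets_def)
    then have "the_set (inv_into ?S k x) \<in> Hset \<theta>"
      by (intro Hset_subset[OF w1]) (simp add: elts_the_set_subset)
    then show ?thesis using True by (simp add: F_def)
  qed (simp add: F_def that)
  then have "almost_all \<theta> I (\<lambda>M. \<forall>x\<in>M. \<forall>y\<in>M. F x y \<in> M)" by (rule almost_all_closed[OF I])
  then obtain M where M: "M \<in> G_omega1" "omega1 \<in> M" "\<forall>x\<in>M. \<forall>y\<in>M. F x y \<in> M"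
    using almost_all_ex[OF I almost_all_conj[OF I G almost_all_conj[OF I almost_all_fine[OF I w1]]]]
    by blast
  have sub: "elts omega1 \<subseteq> M" using M(1) by (simp add: G_omega1_def)
  show False
  proof (rule guessing_not_all_countable[OF M(1,2)])
    fix s assume s: "s \<in> ?S"
    have "k s \<in> M" using k(2) s sub by blast
    moreover have "F (k s) (k s) = the_set s" using s k(1) by (simp add: F_def)
    ultimately show "the_set s \<in> M" using M(3) by metis
  qed
qed

section \<open>Countable subsets of internally club models\<close>

definition ords :: "'v::set_universe set \<Rightarrow> 'v set" where
  "ords M = {\<alpha> \<in> M. Ord \<alpha>}"

text \<open>On ordinals of \<open>M\<close>, collapsing along \<open>ords M\<close> agrees with
  collapsing along \<open>M\<close>, and it connects directly with \<open>otp\<close>.\<close>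

definition collapsed :: "'v::set_universe set \<Rightarrow> 'v set set" where
  "collapsed M = {collapse (ords M) ` x | x. x \<subseteq> ords M \<and> countable x \<and> x \<in> elts ` M}"

text \<open>
  The map \<open>r\<close> enumerates the countable subsets of \<open>\<omega>\<^sub>1\<close> by ordinals below \<open>\<omega>\<^sub>2\<close>.  A subset \<open>y\<close> of a
  countable set \<open>x\<close> of ordinals is coded by the index of the set of positions of its members in \<open>x\<close>.
\<close>

definition good :: "('v::set_universe set \<Rightarrow> 'v) \<Rightarrow> 'v set \<Rightarrow> bool" where
  "good r M \<longleftrightarrow> M \<in> GIC_omega1 \<and>
     (\<forall>\<alpha>\<in>M. \<forall>\<beta>\<in>elts \<alpha>. \<alpha> \<in> elts omega2 \<longrightarrow> iota \<alpha> \<beta> \<in> M \<longrightarrow> \<beta> \<in> M) \<and>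
     (\<forall>x\<in>M. \<forall>y\<in>M. countable (elts x) \<longrightarrow> (\<forall>\<beta>\<in>elts x. Ord \<beta>) \<longrightarrow> elts y \<subseteq> elts x \<longrightarrow>
        r (collapse (elts x) ` elts y) \<in> M) \<and>
     (\<forall>x\<in>M. \<forall>s\<in>ctbl_subsets (elts omega1). r s \<in> M \<longrightarrow>
        the_set {\<beta> \<in> elts x. collapse (elts x) \<beta> \<in> s} \<in> M) \<and>
     (\<forall>x\<in>M. \<forall>y\<in>M. the_set (elts x \<inter> elts y) \<in> M)"

lemma collapse_image_mem_ctbl_subsets:
  fixes x y :: "'v::set_universe set"
  assumes "countable x" "\<And>\<beta>. \<beta> \<in> x \<Longrightarrow> Ord \<beta>" "y \<subseteq> x"
  shows "collapse x ` y \<in> ctbl_subsets (elts omega1)"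
  using assms countable_subset[OF assms(3,1)] collapse_mem_omega1[OF _ assms(1)]
  by (auto simp: ctbl_subsets_def)

lemma almost_all_good:
  fixes I :: "'v::set_universe set set set"
  assumes I: "ideal \<theta> I" and G: "almost_all \<theta> I (\<lambda>M. M \<in> GIC_omega1)"
    and r: "inj_on r (ctbl_subsets (elts (omega1 :: 'v)))"
      "r ` ctbl_subsets (elts (omega1 :: 'v)) \<subseteq> elts omega2"
  shows "almost_all \<theta> I (good r)"
proof -
  let ?S = "ctbl_subsets (elts (omega1 :: 'v))"
  have H: "elts omega2 \<subseteq> Hset \<theta>" using I by (intro omega2_subset_Hset) (simp add: ideal_def)
  \<comment> \<open>The defaults of \<open>F1\<close> and \<open>F2\<close> are arguments, so that
    all values stay in \<open>Hset \<theta>\<close>.\<close>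
  define F1 where "F1 \<alpha> i = (if \<alpha> \<in> elts omega2 \<and> i \<in> iota \<alpha> ` elts \<alpha>
    then inv_into (elts \<alpha>) (iota \<alpha>) i else \<alpha>)" for \<alpha> i :: 'v
  define F2 where "F2 x y = (if countable (elts x) \<and> (\<forall>\<beta>\<in>elts x. Ord \<beta>) \<and> elts y \<subseteq> elts x
    then r (collapse (elts x) ` elts y) else x)" for x y :: 'v
  \<comment> \<open>The existential decodes \<open>j\<close> without a partial inverse of
    \<open>r\<close>; by injectivity at most one \<open>s\<close> qualifies.\<close>
  define F3 where "F3 x j = the_set {\<beta> \<in> elts x. \<exists>s\<in>?S. r s = j \<and> collapse (elts x) \<beta> \<in> s}" for x j :: 'v
  define F4 where "F4 x y = the_set (elts x \<inter> elts y)" for x y :: 'v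
  have "F1 \<alpha> i \<in> Hset \<theta>" if "\<alpha> \<in> Hset \<theta>" "i \<in> Hset \<theta>" for \<alpha> i
    using inv_into_into[of i "iota \<alpha>" "elts \<alpha>"] Ord_mem_trans[OF omega2(1)] H that
    by (auto simp: F1_def)
  from almost_all_closed[OF I this]
  have 1: "almost_all \<theta> I (\<lambda>M. \<forall>x\<in>M. \<forall>y\<in>M. F1 x y \<in> M)" .
  have "F2 x y \<in> Hset \<theta>" if "x \<in> Hset \<theta>" "y \<in> Hset \<theta>" for x y
    using collapse_image_mem_ctbl_subsets[of "elts x" "elts y"] r(2) H that by (auto simp: F2_def)
  from almost_all_closed[OF I this]
  have 2: "almost_all \<theta> I (\<lambda>M. \<forall>x\<in>M. \<forall>y\<in>M. F2 x y \<in> M)" .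
  have sub: "the_set A \<in> Hset \<theta>" if "x \<in> Hset \<theta>" "A \<subseteq> elts x" for A x
    using elts_the_set_subset[OF that(2)] that by (intro Hset_subset[OF that(1)]) simp
  have "F3 x j \<in> Hset \<theta>" if "x \<in> Hset \<theta>" "j \<in> Hset \<theta>" for x j
    unfolding F3_def by (rule sub[OF that(1)]) blast
  from almost_all_closed[OF I this]
  have 3: "almost_all \<theta> I (\<lambda>M. \<forall>x\<in>M. \<forall>y\<in>M. F3 x y \<in> M)" .
  have "F4 x y \<in> Hset \<theta>" if "x \<in> Hset \<theta>" "y \<in> Hset \<theta>" for x y
    unfolding F4_def by (rule sub[OF that(1)]) blast
  from almost_all_closed[OF I this]
  have 4: "almost_all \<theta> I (\<lambda>M. \<forall>x\<in>M. \<forall>y\<in>M. F4 x y \<in> M)" .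
  show ?thesis
  proof (rule almost_all_mono[OF I almost_all_conj[OF I G almost_all_conj[OF I 1
          almost_all_conj[OF I 2 almost_all_conj[OF I 3 4]]]]])
    fix M assume M: "M \<in> GIC_omega1 \<and> (\<forall>x\<in>M. \<forall>y\<in>M. F1 x y \<in> M) \<and> (\<forall>x\<in>M. \<forall>y\<in>M. F2 x y \<in> M) \<and>
      (\<forall>x\<in>M. \<forall>y\<in>M. F3 x y \<in> M) \<and> (\<forall>x\<in>M. \<forall>y\<in>M. F4 x y \<in> M)"
    show "good r M"
      unfolding good_def
    proof (intro conjI ballI impI)
      show "M \<in> GIC_omega1" using M by blast
    next
      fix \<alpha> \<beta> assume *: "\<alpha> \<in> M" "\<beta> \<in> elts \<alpha>" "\<alpha> \<in> elts omega2" "iota \<alpha> \<beta> \<in> M"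
      then have "F1 \<alpha> (iota \<alpha> \<beta>) = \<beta>" using inv_into_f_f[OF iota(1)[OF *(3)]] by (simp add: F1_def)
      then show "\<beta> \<in> M" using M * by metis
    next
      fix x y assume *: "x \<in> M" "y \<in> M" "countable (elts x)" "\<forall>\<beta>\<in>elts x. Ord \<beta>" "elts y \<subseteq> elts x"
      then have "F2 x y = r (collapse (elts x) ` elts y)" by (simp add: F2_def)
      then show "r (collapse (elts x) ` elts y) \<in> M" using M * by metis
    next
      fix x s assume *: "x \<in> M" "s \<in> ?S" "r s \<in> M"
      have "t = s" if "t \<in> ?S" "r t = r s" for t using r(1) *(2) that by (auto dest: inj_onD)
      then have "F3 x (r s) = the_set {\<beta> \<in> elts x. collapse (elts x) \<beta> \<in> s}"
        using *(2) unfolding F3_def by (intro arg_cong[of _ _ the_set]) blast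
      then show "the_set {\<beta> \<in> elts x. collapse (elts x) \<beta> \<in> s} \<in> M" using M * by metis
    next
      fix x y assume "x \<in> M" "y \<in> M"
      then show "the_set (elts x \<inter> elts y) \<in> M" using M unfolding F4_def by blast
    qed
  qed
qed

lemma
  fixes M :: "'v::set_universe set"
  assumes good: "good r M"
  shows good_GIC: "M \<in> GIC_omega1"
    and good_iota: "\<alpha> \<in> M \<Longrightarrow> \<beta> \<in> elts \<alpha> \<Longrightarrow> \<alpha> \<in> elts omega2 \<Longrightarrow> iota \<alpha> \<beta> \<in> M \<Longrightarrow> \<beta> \<in> M"
    and good_code: "x \<in> M \<Longrightarrow> y \<in> M \<Longrightarrow> countable (elts x) \<Longrightarrow> \<forall>\<beta>\<in>elts x. Ord \<beta> \<Longrightarrow>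
      elts y \<subseteq> elts x \<Longrightarrow> r (collapse (elts x) ` elts y) \<in> M"
    and good_decode: "x \<in> M \<Longrightarrow> s \<in> ctbl_subsets (elts omega1) \<Longrightarrow> r s \<in> M \<Longrightarrow>
      the_set {\<beta> \<in> elts x. collapse (elts x) \<beta> \<in> s} \<in> M"
    and good_Int: "x \<in> M \<Longrightarrow> y \<in> M \<Longrightarrow> the_set (elts x \<inter> elts y) \<in> M"
    and good_omega1_subset: "elts omega1 \<subseteq> M"
    and good_lepoll: "M \<lesssim> elts (omega1 :: 'v)"
proof -
  note g = good[unfolded good_def]
  show GIC: "M \<in> GIC_omega1" by (rule conjunct1[OF g])
  show "\<beta> \<in> M" if "\<alpha> \<in> M" "\<beta> \<in> elts \<alpha>" "\<alpha> \<in> elts omega2" "iota \<alpha> \<beta> \<in> M"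
    using conjunct1[OF conjunct2[OF g]] that by blast
  show "r (collapse (elts x) ` elts y) \<in> M"
    if "x \<in> M" "y \<in> M" "countable (elts x)" "\<forall>\<beta>\<in>elts x. Ord \<beta>" "elts y \<subseteq> elts x"
    using conjunct1[OF conjunct2[OF conjunct2[OF g]], rule_format, of x y] that by blast
  show "the_set {\<beta> \<in> elts x. collapse (elts x) \<beta> \<in> s} \<in> M"
    if "x \<in> M" "s \<in> ctbl_subsets (elts omega1)" "r s \<in> M"
    using conjunct1[OF conjunct2[OF conjunct2[OF conjunct2[OF g]]]] that by simp
  show "the_set (elts x \<inter> elts y) \<in> M" if "x \<in> M" "y \<in> M"
    using conjunct2[OF conjunct2[OF conjunct2[OF conjunct2[OF g]]]] that by simp
  show "elts omega1 \<subseteq> M" "M \<lesssim> elts (omega1 :: 'v)"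
    using GIC by (simp_all add: GIC_omega1_def G_omega1_def eqpoll_imp_lepoll)
qed

text \<open>The trace is transitive: \<open>iota \<alpha> \<beta>\<close> is a countable ordinal,
  hence in \<open>M\<close>, and \<open>M\<close> recovers \<open>\<beta>\<close> from it and
  \<open>\<alpha>\<close>.\<close>

lemma good_Int_omega2:
  fixes M :: "'v::set_universe set"
  assumes "good r M"
  obtains \<delta> where "\<delta> \<in> elts omega2" "M \<inter> elts omega2 = elts \<delta>"
proof -
  have "\<beta> \<in> M \<inter> elts omega2" if "\<alpha> \<in> M" "\<alpha> \<in> elts omega2" "\<beta> \<in> elts \<alpha>" for \<alpha> \<beta>
  proof -
    have "iota \<alpha> \<beta> \<in> M" using iota(2)[OF that(2,3)] good_omega1_subset[OF assms] by blast
    then show ?thesis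
      using good_iota[OF assms that(1,3,2)] Ord_mem_trans[OF omega2(1) that(2,3)] by blast
  qed
  then have "transitive (M \<inter> elts omega2)" unfolding transitive_def by blast
  then obtain \<delta> where \<delta>: "Ord \<delta>" "elts \<delta> = M \<inter> elts omega2"
    by (rule transitive_subset_Ord[OF omega2(1) Int_lower2])
  have "elts \<delta> \<lesssim> elts (omega1 :: 'v)"
    unfolding \<delta>(2) using lepoll_trans[OF subset_imp_lepoll[OF Int_lower1] good_lepoll[OF assms]] .
  then show thesis using that \<delta> mem_omega2 by blast
qed

lemma elts_otp_ords:
  fixes M :: "'v::set_universe set"
  assumes "good r M"
  shows "elts (otp (ords M)) = collapse (ords M) ` ords M"
proof -
  obtain f where "M \<subseteq> f ` elts (omega1 :: 'v)"
    using good_lepoll[OF assms] by (auto simp: lepoll_iff)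
  moreover obtain x where "elts x = f ` elts (omega1 :: 'v)" using replacement[of "elts omega1" omega1 f] by blast
  ultimately have "ords M \<subseteq> elts x" by (auto simp: ords_def)
  then show ?thesis by (intro elts_otp) (auto simp: ords_def)
qed

lemma otp_ords_downward:
  assumes "good r M" "\<eta> \<in> elts (otp (ords M))" "\<zeta> \<in> elts \<eta>"
  shows "\<zeta> \<in> elts (otp (ords M))"
  using assms(2,3) unfolding elts_otp_ords[OF assms(1)] by (auto simp: elts_collapse)

lemma collapsedI:
  "x \<subseteq> ords M \<Longrightarrow> countable x \<Longrightarrow> x \<in> elts ` M \<Longrightarrow> collapse (ords M) ` x \<in> collapsed M"
  unfolding collapsed_def by (intro CollectI exI[of _ x]) simp

lemma collapsedE:
  assumes "d \<in> collapsed M"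
  obtains x where "x \<in> M" "elts x \<subseteq> ords M" "countable (elts x)" "d = collapse (ords M) ` elts x"
  using assms unfolding collapsed_def by blast

text \<open>The internal club of \<open>M\<close> is restricted to the ordinals of \<open>M\<close>
  below the preimage of \<open>\<zeta>\<close> and moved by the collapse. The restrictions are still
  members of \<open>M\<close> by \<open>good_Int\<close>.\<close>

lemma good_club:
  fixes M :: "'v::set_universe set"
  assumes M: "good r M" and \<zeta>: "\<zeta> \<in> elts (otp (ords M))"
  obtains C where "club (elts \<zeta>) C" "C \<subseteq> collapsed M"
proof -
  obtain C where C: "club M C" "C \<subseteq> elts ` M \<inter> ctbl_subsets M"
    using good_GIC[OF M] by (auto simp: GIC_omega1_def IC_omega1_def)
  obtain \<beta> where \<beta>: "\<beta> \<in> ords M" "\<zeta> = collapse (ords M) \<beta>"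
    using \<zeta> unfolding elts_otp_ords[OF M] by blast
  define X where "X = elts \<beta> \<inter> ords M"
  have XO: "X \<subseteq> ords M" unfolding X_def by blast
  have XM: "X = elts \<beta> \<inter> M" using \<beta>(1) Ord_member unfolding X_def ords_def by blast
  have XsubM: "X \<subseteq> M" unfolding XM by blast
  have inj: "inj_on (collapse (ords M)) X"
    by (rule inj_on_subset[OF inj_on_collapse XO]) (simp add: ords_def)
  obtain D where D: "club (collapse (ords M) ` X) D" "D \<subseteq> (\<lambda>a. collapse (ords M) ` (a \<inter> X)) ` C"
    by (rule club_project[OF C(1) XsubM inj])
  have "collapse (ords M) ` (a \<inter> X) \<in> collapsed M" if aC: "a \<in> C" for a
  proof -
    obtain z where z: "z \<in> M" "a = elts z" "a \<subseteq> M" "countable a"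
      using subsetD[OF C(2) aC] by (auto simp: ctbl_subsets_def)
    have m: "the_set (elts z \<inter> elts \<beta>) \<in> M"
      using \<beta>(1) by (intro good_Int[OF M z(1)]) (simp add: ords_def)
    have "a \<inter> X = elts z \<inter> elts \<beta>" using z XM by blast
    also have "\<dots> = elts (the_set (elts z \<inter> elts \<beta>))"
      by (rule elts_the_set_subset[OF Int_lower1, symmetric])
    finally have "a \<inter> X \<in> elts ` M" using m by (rule image_eqI)
    then show ?thesis using XO z(4) by (intro collapsedI) auto
  qed
  then have "D \<subseteq> collapsed M" using D(2) by blast
  moreover have "elts \<zeta> = collapse (ords M) ` X" by (simp add: \<beta>(2) elts_collapse X_def)
  ultimately show thesis using D(1) by (intro that) auto
qed

lemma collapse_collapse_ords:
  fixes M :: "'v::set_universe set"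
  assumes "x \<subseteq> ords M" "\<beta> \<in> x"
  shows "collapse (collapse (ords M) ` x) (collapse (ords M) \<beta>) = collapse x \<beta>"
  using assms collapse_mem_iff[of _ _ "ords M"] by (intro collapse_image) (auto simp: ords_def)

text \<open>The collapse preserves positions, so the code of \<open>a\<close> in \<open>d\<close> is
  the code of their preimages, and \<open>M\<close> is closed under coding.\<close>

lemma collapsed_code:
  fixes M :: "'v::set_universe set"
  assumes M: "good r M" and d: "d \<in> collapsed M" and a: "a \<in> collapsed M" "a \<subseteq> d"
  shows "r (collapse d ` a) \<in> M"
proof -
  let ?\<pi> = "collapse (ords M)"
  obtain x where x: "x \<in> M" "elts x \<subseteq> ords M" "countable (elts x)" "d = ?\<pi> ` elts x"
    using d by (rule collapsedE)
  obtain y where y: "y \<in> M" "elts y \<subseteq> ords M" "countable (elts y)" "a = ?\<pi> ` elts y"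
    using a(1) by (rule collapsedE)
  have inj: "inj_on ?\<pi> (ords M)" by (rule inj_on_collapse) (simp add: ords_def)
  have yx: "elts y \<subseteq> elts x"
  proof
    fix z assume z: "z \<in> elts y"
    then have "?\<pi> z \<in> ?\<pi> ` elts x" using a(2) unfolding x(4) y(4) by blast
    moreover have "z \<in> ords M" using z y(2) by blast
    ultimately show "z \<in> elts x" using inj_on_image_mem_iff[OF inj _ x(2)] by blast
  qed
  have "collapse d ` a = collapse (elts x) ` elts y"
    unfolding x(4) y(4) image_image
    by (rule image_cong[OF refl]) (use yx in \<open>auto intro: collapse_collapse_ords[OF x(2)]\<close>)
  moreover have "\<forall>\<beta>\<in>elts x. Ord \<beta>" using x(2) by (auto simp: ords_def)
  then have "r (collapse (elts x) ` elts y) \<in> M" using good_code[OF M x(1) y(1) x(3) _ yx] by blast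
  ultimately show ?thesis by simp
qed

lemma collapsed_decode:
  fixes M :: "'v::set_universe set"
  assumes M: "good r M" and d: "d \<in> collapsed M"
    and s: "s \<in> ctbl_subsets (elts omega1)" "r s \<in> M"
  shows "{\<beta> \<in> d. collapse d \<beta> \<in> s} \<in> collapsed M"
proof -
  let ?\<pi> = "collapse (ords M)"
  obtain x where x: "x \<in> M" "elts x \<subseteq> ords M" "countable (elts x)" "d = ?\<pi> ` elts x"
    using d by (rule collapsedE)
  let ?y = "{\<beta> \<in> elts x. collapse (elts x) \<beta> \<in> s}"
  have "the_set ?y \<in> M" by (rule good_decode[OF M x(1) s])
  have "elts (the_set ?y) = ?y" by (rule elts_the_set_subset) blast
  then have "?y \<in> elts ` M" using \<open>the_set ?y \<in> M\<close> by (intro image_eqI[of _ _ "the_set ?y"]) simp_all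
  moreover have "?y \<subseteq> ords M" using x(2) by blast
  moreover have "countable ?y" by (rule countable_subset[OF _ x(3)]) blast
  moreover have "{\<beta> \<in> d. collapse d \<beta> \<in> s} = ?\<pi> ` ?y"
    unfolding x(4) using collapse_collapse_ords[OF x(2)] by auto
  ultimately show ?thesis by (simp add: collapsedI)
qed

lemma collapsed_Ord:
  fixes M :: "'v::set_universe set"
  shows "d \<in> collapsed M \<Longrightarrow> \<beta> \<in> d \<Longrightarrow> Ord \<beta>"
  unfolding collapsed_def ords_def using Ord_collapse by blast

lemma collapsed_countable: "d \<in> collapsed M \<Longrightarrow> countable d"
  unfolding collapsed_def by auto

lemma decode_code:
  fixes a d :: "'v::set_universe set"
  assumes "a \<subseteq> d" "\<And>\<beta>. \<beta> \<in> d \<Longrightarrow> Ord \<beta>"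
  shows "{\<beta> \<in> d. collapse d \<beta> \<in> collapse d ` a} = a"
  using inj_on_collapse[OF assms(2)] assms(1) by (auto dest: inj_onD)

text \<open>The clubs given by \<open>M\<close> and \<open>M'\<close> share a superset
  \<open>d\<close> of \<open>a\<close>. The code of \<open>a\<close> in \<open>d\<close> is an
  ordinal of \<open>M\<close> below \<open>omega2\<close>, hence in \<open>M'\<close>, where it is
  decoded relative to the same \<open>d\<close>.\<close>

lemma collapsed_coherent:
  fixes M M' :: "'v::set_universe set"
  assumes M: "good r M" "good r M'" and eq: "M \<inter> elts omega2 = M' \<inter> elts omega2"
    and r: "r ` ctbl_subsets (elts (omega1 :: 'v)) \<subseteq> elts omega2"
    and \<zeta>: "\<zeta> \<in> elts (otp (ords M))" "\<zeta> \<in> elts (otp (ords M'))"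
    and a: "a \<in> collapsed M" "a \<subseteq> elts \<zeta>"
  shows "a \<in> collapsed M'"
proof -
  obtain C where C: "club (elts \<zeta>) C" "C \<subseteq> collapsed M" by (rule good_club[OF M(1) \<zeta>(1)])
  obtain D where D: "club (elts \<zeta>) D" "D \<subseteq> collapsed M'" by (rule good_club[OF M(2) \<zeta>(2)])
  have "a \<in> ctbl_subsets (elts \<zeta>)" using collapsed_countable[OF a(1)] a(2) by (simp add: ctbl_subsets_def)
  then obtain d where "d \<in> C" "d \<in> D" "a \<subseteq> d" by (rule club_Int_cofinal[OF C(1) D(1)])
  then have d: "d \<in> collapsed M" "d \<in> collapsed M'" "a \<subseteq> d" using C(2) D(2) by auto
  have s: "collapse d ` a \<in> ctbl_subsets (elts omega1)"
    using collapse_image_mem_ctbl_subsets[OF collapsed_countable[OF d(1)] collapsed_Ord[OF d(1)] d(3)] .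
  have "r (collapse d ` a) \<in> M" by (rule collapsed_code[OF M(1) d(1) a(1) d(3)])
  then have "r (collapse d ` a) \<in> M'" using eq r s by blast
  from collapsed_decode[OF M(2) d(2) s this] show ?thesis
    using decode_code[OF d(3) collapsed_Ord[OF d(1)]] by simp
qed

section \<open>From a coherent family of clubs to CH and a contradiction\<close>

theorem theorem25:
  assumes "RP (omega2 :: 'v::set_universe)"
  shows "\<not> (\<exists>(\<theta>::'v) I. ideal \<theta> I \<and> bounds_completeness \<theta> I \<and> concentrates_on \<theta> I GIC_omega1)"
proof
  assume "\<exists>(\<theta>::'v) I. ideal \<theta> I \<and> bounds_completeness \<theta> I \<and> concentrates_on \<theta> I GIC_omega1"
  then obtain \<theta> :: 'v and I where I: "ideal \<theta> I" and b: "bounds_completeness \<theta> I"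
    and "concentrates_on \<theta> I GIC_omega1" by blast
  then have G: "almost_all \<theta> I (\<lambda>M. M \<in> GIC_omega1)" by (intro almost_all_concentrates)
  let ?S = "ctbl_subsets (elts (omega1 :: 'v))"
  have "?S \<lesssim> elts (omega2 :: 'v)"
    by (rule ctbl_subsets_omega1_lepoll[OF RP_continuum[OF assms]
          subset_imp_lepoll[OF omega1_subset_omega2]])
  then obtain r where r: "inj_on r ?S" "r ` ?S \<subseteq> elts (omega2 :: 'v)" unfolding lepoll_def by blast
  obtain \<mu> where \<mu>: "completeness I \<mu>" "\<And>f. f \<in> elts \<mu> \<rightarrow> elts \<mu> \<Longrightarrow>
      {M \<in> Zset \<theta>. f (the_set (M \<inter> elts \<mu>)) \<in> elts (otp {\<alpha> \<in> M. Ord \<alpha>})} \<in> dual_filter \<theta> I"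
    using b unfolding bounds_completeness_def by blast
  have "\<mu> = omega2"
  proof (rule completeness_eq_omega2[OF I \<mu>(1)])
    show "almost_all \<theta> I (\<lambda>M. elts omega1 \<subseteq> M)"
      by (rule almost_all_mono[OF I G]) (auto simp: GIC_omega1_def G_omega1_def)
    show "almost_all \<theta> I (\<lambda>M. M \<lesssim> elts (omega1 :: 'v))"
      by (rule almost_all_mono[OF I G]) (auto simp: GIC_omega1_def G_omega1_def eqpoll_imp_lepoll)
  qed
  have good: "almost_all \<theta> I (good r)" by (rule almost_all_good[OF I G r])
  \<comment> \<open>If every \<open>\<delta>\<close> had an unreachable \<open>f \<delta>\<close>,
    bounding applied to \<open>f\<close> would give a good \<open>M\<close> with trace
    \<open>\<delta>\<close> and order type above \<open>f \<delta>\<close>.\<close>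
  have "\<exists>\<delta>\<in>elts omega2. \<forall>\<zeta>\<in>elts omega2. \<exists>M. good r M \<and> M \<inter> elts omega2 = elts \<delta> \<and>
      \<zeta> \<in> elts (otp (ords M))"
  proof (rule ccontr)
    assume "\<not> ?thesis"
    then obtain f where f: "\<And>\<delta>. \<delta> \<in> elts omega2 \<Longrightarrow> f \<delta> \<in> elts omega2 \<and>
        \<not> (\<exists>M. good r M \<and> M \<inter> elts omega2 = elts \<delta> \<and> f \<delta> \<in> elts (otp (ords M)))"
      by metis
    have "f \<in> elts omega2 \<rightarrow> elts omega2" using f by blast
    from almost_all_dual[OF \<mu>(2)[unfolded \<open>\<mu> = omega2\<close>, OF this] I]
    obtain M where M: "f (the_set (M \<inter> elts omega2)) \<in> elts (otp (ords M))" "good r M"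
      unfolding ords_def by (rule almost_all_ex[OF I almost_all_conj[OF I _ good]]) blast
    obtain \<delta> where \<delta>: "\<delta> \<in> elts omega2" "M \<inter> elts omega2 = elts \<delta>" by (rule good_Int_omega2[OF M(2)])
    then show False using M f[OF \<delta>(1)] by auto
  qed
  then obtain \<delta> where \<delta>: "\<delta> \<in> elts (omega2 :: 'v)"
    and "\<forall>\<zeta>\<in>elts omega2. \<exists>M. good r M \<and> M \<inter> elts omega2 = elts \<delta> \<and> \<zeta> \<in> elts (otp (ords M))"
    by blast
  then obtain N where N: "\<And>\<zeta>. \<zeta> \<in> elts omega2 \<Longrightarrow> good r (N \<zeta>)"
    "\<And>\<zeta>. \<zeta> \<in> elts omega2 \<Longrightarrow> N \<zeta> \<inter> elts omega2 = elts \<delta>"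
    "\<And>\<zeta>. \<zeta> \<in> elts omega2 \<Longrightarrow> \<zeta> \<in> elts (otp (ords (N \<zeta>)))"
    by metis
  define D where "D \<zeta> = collapsed (N \<zeta>) \<inter> ctbl_subsets (elts \<zeta>)" for \<zeta>
  \<comment> \<open>The height of \<open>N \<zeta>'\<close> also exceeds \<open>\<zeta>\<close>, so
    coherence can be applied at \<open>\<zeta>\<close>.\<close>
  have coh: "a \<in> D \<zeta>'" if "a \<in> D \<zeta>" "\<zeta> \<in> elts omega2" "\<zeta>' \<in> elts omega2" "elts \<zeta> \<subseteq> elts \<zeta>'" for a \<zeta> \<zeta>'
  proof -
    have "\<zeta> = \<zeta>' \<or> \<zeta> \<in> elts \<zeta>'"
      using Ord_linear[of \<zeta> \<zeta>'] Ord_member[OF omega2(1)] that mem_irrefl[of \<zeta>'] by blast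
    then have "\<zeta> \<in> elts (otp (ords (N \<zeta>')))"
      using N(3)[OF that(3)] otp_ords_downward[OF N(1)[OF that(3)]] by blast
    moreover have "N \<zeta> \<inter> elts omega2 = N \<zeta>' \<inter> elts omega2" using N(2) that(2,3) by simp
    moreover have a: "a \<in> collapsed (N \<zeta>)" "a \<subseteq> elts \<zeta>" "countable a"
      using that(1) by (auto simp: D_def ctbl_subsets_def)
    ultimately have "a \<in> collapsed (N \<zeta>')"
      by (intro collapsed_coherent[OF N(1)[OF that(2)] N(1)[OF that(3)] _ r(2) N(3)[OF that(2)]])
    then show ?thesis using a that(4) by (auto simp: D_def ctbl_subsets_def)
  qed
  have ex: "\<exists>C. club (elts \<zeta>) C \<and> C \<subseteq> D \<zeta>" if \<zeta>: "\<zeta> \<in> elts omega2" for \<zeta>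
  proof -
    obtain C where C: "club (elts \<zeta>) C" "C \<subseteq> collapsed (N \<zeta>)" by (rule good_club[OF N(1,3)[OF \<zeta>]])
    have "C \<subseteq> ctbl_subsets (elts \<zeta>)" using C(1) by (simp add: club_def)
    then show ?thesis using C unfolding D_def by blast
  qed
  obtain C where C: "club (elts (omega2 :: 'v)) C" "C \<subseteq> (\<Union>\<zeta>\<in>elts omega2. D \<zeta>)"
    by (rule RP_union_contains_club[OF assms ex])
  obtain b where b: "b \<in> ctbl_subsets (elts omega2)" "(UNIV :: (nat \<Rightarrow> bool) set) \<lesssim> {a \<in> C. a \<subseteq> b}"
    by (rule club_many_subsets[OF C(1)])
  \<comment> \<open>The common superset \<open>d\<close> is taken in the club itself, so that it
    lies in some model and can serve as reference for all codes.\<close>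
  obtain d where d: "d \<in> C" "b \<subseteq> d" using C(1) b(1) unfolding club_def by blast
  obtain \<eta> where \<eta>: "\<eta> \<in> elts omega2" "d \<in> D \<eta>" using C(2) d(1) by blast
  have dO: "\<And>\<beta>. \<beta> \<in> d \<Longrightarrow> Ord \<beta>" using \<eta>(2) collapsed_Ord unfolding D_def by blast
  have code: "r (collapse d ` a) \<in> elts \<delta>" "collapse d ` a \<in> ?S" if a: "a \<in> C" "a \<subseteq> b" for a
  proof -
    obtain \<zeta> where \<zeta>: "\<zeta> \<in> elts omega2" "a \<in> D \<zeta>" using C(2) a(1) by blast
    have "elts \<zeta> \<subseteq> elts \<eta> \<or> elts \<eta> \<subseteq> elts \<zeta>"
      using Ord_linear[of \<zeta> \<eta>] Ord_member[OF omega2(1)] \<zeta>(1) \<eta>(1) Ord_mem_trans by blast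
    \<comment> \<open>The larger of the two levels contains both sets. The code then lies in
      \<open>N \<xi>\<close>, whose trace on \<open>omega2\<close> is \<open>\<delta>\<close> for
      every \<open>\<xi>\<close>.\<close>
    then obtain \<xi> where \<xi>: "\<xi> \<in> elts omega2" "a \<in> D \<xi>" "d \<in> D \<xi>" using coh \<zeta> \<eta> by blast
    have "r (collapse d ` a) \<in> N \<xi>"
      using \<xi>(2,3) a(2) d(2) by (intro collapsed_code[OF N(1)[OF \<xi>(1)]]) (auto simp: D_def)
    moreover show s: "collapse d ` a \<in> ?S"
      using \<xi>(3) a(2) d(2)
      by (intro collapse_image_mem_ctbl_subsets dO) (auto simp: D_def ctbl_subsets_def)
    ultimately show "r (collapse d ` a) \<in> elts \<delta>" using r(2) N(2)[OF \<xi>(1)] by blast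
  qed
  have "inj_on (\<lambda>a. r (collapse d ` a)) {a \<in> C. a \<subseteq> b}"
  proof (rule inj_onI)
    fix a a' assume *: "a \<in> {a \<in> C. a \<subseteq> b}" "a' \<in> {a \<in> C. a \<subseteq> b}"
      "r (collapse d ` a) = r (collapse d ` a')"
    then have "collapse d ` a = collapse d ` a'" using code(2) inj_onD[OF r(1)] by blast
    moreover have "a \<subseteq> d" "a' \<subseteq> d" using * d(2) by auto
    ultimately show "a = a'" using decode_code[OF _ dO] by metis
  qed
  then have "{a \<in> C. a \<subseteq> b} \<lesssim> elts \<delta>" using code(1) unfolding lepoll_def by blast
  from lepoll_trans[OF lepoll_trans[OF b(2) this] omega2(3)[OF \<delta>]]
  have "(UNIV :: (nat \<Rightarrow> bool) set) \<lesssim> elts (omega1 :: 'v)" .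
  then have "?S \<lesssim> elts (omega1 :: 'v)" by (rule ctbl_subsets_omega1_lepoll) simp
  moreover have "almost_all \<theta> I (\<lambda>M. M \<in> G_omega1)"
    by (rule almost_all_mono[OF I G]) (simp add: GIC_omega1_def)
  ultimately show False using guessing_ideal_not_CH[OF I] by blast
qed

end
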